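(* Let $X=(x_1\ \cdots\ x_n)\in\mathbb{R}^{d\times n}$ be a data matrix and let $\{u_i\}_{i=1}^d$ be an orthonormal basis of $\mathbb{R}^d$ of left singular vectors of $X$, with $u_i$ associated with the singular value $\sigma_i(X)$. Let $D$ denote the differential operator $Df=f'$ on $\mathcal{H}$. For the minimum mean quadratic variation problem $$\min_{\Phi\in \mathcal{I}(\mathbb{R}^d, \mathcal{H})} \frac{1}{n} \sum_{i=1}^n\Vert D \Phi(x_i)\Vert_{L^2([0,1])}^2,$$ the lower bound on the objective is $\frac{1}{n}\sum_{k=2}^d 4\pi^2 \lfloor k/2\rfloor^2\sigma_k(X)^2$. This lower bound is attained for all $\Phi$ of the form $$\Phi(x) = \pm(u_1^Tx)\mathbf{1} + \sum_{k=2}^d (u_k^T x)\, \phi_k,$$ where, for all $j\ge 1$, $\{\phi_{2j},\phi_{2j+1}\}$ is an orthonormal basis (in $L^2([0,1])$) for $$\mathrm{span}_{\mathbb{R}}\{\sqrt{2}\cos(2\pi j t),\ \sqrt{2}\sin(2\pi j t)\}$$ (only indices $\le d$ are used; thus when $d$ is even, $\phi_d$ is simply a unit vector in this span with $j=d/2$). These are the only minimizers if $\sigma_1(X),\dots,\sigma_d(X)$ are all distinct and non-zero.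
   Context: $L^2([0,1])$ is the space of real-valued square-integrable functions on $[0,1]$, and $\mathcal{H}=\{f\in L^2([0,1]): f'\in L^2([0,1])\}$ is the Sobolev space of periodic functions, i.e. $[0,1]$ is identified with the circle $\mathbb{R}/\mathbb{Z}$ and $f'$ is the weak derivative on the circle, so that $\widehat{f'}[k]=2\pi\sqrt{-1}\,k\hat f[k]$ for all $k\in\mathbb{Z}$, where $f(t)=\sum_{k\in\mathbb{Z}}\hat f[k]e^{2\pi \sqrt{-1}\, k t}$. $\mathcal{I}(\mathbb{R}^d,\mathcal{H})$ is the set of linear isometries from $\mathbb{R}^d$ to $L^2([0,1])$ (with the $L^2$ norm) whose images are contained in $\mathcal{H}$. $\mathbf{1}$ is the constant function $1$. $\sigma_1(X)\ge\cdots\ge\sigma_d(X)\ge0$ are the singular values of $X$, i.e. the square roots of the $d$ eigenvalues of $XX^T$ with multiplicity; left singular vectors associated with $\sigma_i(X)$ are eigenvectors of $XX^T$ with eigenvalue $\sigma_i(X)^2$. *)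

theory Defs
  imports "HOL-Analysis.Analysis" "HOL-Computational_Algebra.Polynomial"
begin

section \<open>Real-valued square-integrable functions on the unit interval\<close>

abbreviation unit_leb :: "real measure" where
  "unit_leb \<equiv> lebesgue_on {0..1}"

definition square_integrable :: "(real \<Rightarrow> real) \<Rightarrow> bool" where
  "square_integrable f \<longleftrightarrow>
     f \<in> borel_measurable unit_leb \<and> integrable unit_leb (\<lambda>t. (f t)\<^sup>2)"

lemma square_integrable_measurable [measurable_dest]:
  "square_integrable f \<Longrightarrow> f \<in> borel_measurable unit_leb"
  by (simp add: square_integrable_def)

lemma square_integrable_mult:
  assumes "square_integrable f" "square_integrable g"
  shows "integrable unit_leb (\<lambda>t. f t * g t)"
proof (rule Bochner_Integration.integrable_bound)
  show "integrable unit_leb (\<lambda>t. (f t)\<^sup>2 + (g t)\<^sup>2)"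
    using assms by (auto simp: square_integrable_def)
  show "(\<lambda>t. f t * g t) \<in> borel_measurable unit_leb"
    using assms by (auto simp: square_integrable_def)
  have "\<bar>f t * g t\<bar> \<le> (f t)\<^sup>2 + (g t)\<^sup>2" for t
  proof -
    have "2 * (\<bar>f t\<bar> * \<bar>g t\<bar>) \<le> (f t)\<^sup>2 + (g t)\<^sup>2"
      using sum_squares_bound [of "\<bar>f t\<bar>" "\<bar>g t\<bar>"] by (simp add: mult.assoc)
    moreover have "0 \<le> \<bar>f t\<bar> * \<bar>g t\<bar>"
      by simp
    ultimately show ?thesis
      unfolding abs_mult by linarith
  qed
  then show "AE t in unit_leb. norm (f t * g t) \<le> norm ((f t)\<^sup>2 + (g t)\<^sup>2)"
    by simp
qed

lemma square_integrable_add: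
  assumes "square_integrable f" "square_integrable g"
  shows "square_integrable (\<lambda>t. f t + g t)"
proof -
  have "integrable unit_leb (\<lambda>t. (f t)\<^sup>2 + (g t)\<^sup>2 + 2 * (f t * g t))"
    using assms square_integrable_mult [OF assms] by (auto simp: square_integrable_def)
  then show ?thesis
    using assms by (auto simp: square_integrable_def power2_sum mult.assoc)
qed

lemma square_integrable_scale:
  assumes "square_integrable f"
  shows "square_integrable (\<lambda>t. c * f t)"
  using assms by (auto simp: square_integrable_def power_mult_distrib)

lemma square_integrable_continuous:
  assumes "continuous_on UNIV f"
  shows "square_integrable f"
proof -
  have "continuous_on {0..1} f" "continuous_on {0..1} (\<lambda>t. (f t)\<^sup>2)"
    using assms continuous_on_subset by (auto intro!: continuous_intros)
  then show ?thesis
    unfolding square_integrable_def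
    using continuous_imp_integrable_real [of 0 1 "\<lambda>t. (f t)\<^sup>2"]
      continuous_imp_measurable_on_sets_lebesgue [of "{0..1}" f] by auto
qed

definition ae_eq :: "(real \<Rightarrow> real) \<Rightarrow> (real \<Rightarrow> real) \<Rightarrow> bool" where
  "ae_eq f g \<longleftrightarrow> square_integrable f \<and> square_integrable g \<and> (AE t in unit_leb. f t = g t)"

quotient_type l2 = "real \<Rightarrow> real" / partial: ae_eq
proof (rule part_equivpI)
  show "\<exists>f. ae_eq f f"
    using square_integrable_continuous [of "\<lambda>_. 0"] by (auto simp: ae_eq_def)
  show "symp ae_eq"
    by (auto simp: symp_def ae_eq_def elim: eventually_mono)
  show "transp ae_eq"
  proof (rule transpI)
    fix f g h assume *: "ae_eq f g" "ae_eq g h"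
    then have "AE t in unit_leb. f t = g t" "AE t in unit_leb. g t = h t"
      by (simp_all add: ae_eq_def)
    then have "AE t in unit_leb. f t = h t"
      by eventually_elim simp
    with * show "ae_eq f h"
      by (simp add: ae_eq_def)
  qed
qed

instantiation l2 :: real_inner
begin

lift_definition zero_l2 :: l2 is "\<lambda>_. 0"
  using square_integrable_continuous [of "\<lambda>_. 0"] by (auto simp: ae_eq_def)

lift_definition plus_l2 :: "l2 \<Rightarrow> l2 \<Rightarrow> l2" is "\<lambda>f g t. f t + g t"
  by (auto simp: ae_eq_def square_integrable_add elim: eventually_elim2)

lift_definition scaleR_l2 :: "real \<Rightarrow> l2 \<Rightarrow> l2" is "\<lambda>c f t. c * f t"
  by (auto simp: ae_eq_def square_integrable_scale elim: eventually_mono)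

lift_definition inner_l2 :: "l2 \<Rightarrow> l2 \<Rightarrow> real" is "\<lambda>f g. \<integral>t. f t * g t \<partial>unit_leb"
proof -
  fix f f' g g' assume *: "ae_eq f f'" "ae_eq g g'"
  then have "AE t in unit_leb. f t * g t = f' t * g' t"
    by (auto simp: ae_eq_def elim: eventually_elim2)
  with * show "(\<integral>t. f t * g t \<partial>unit_leb) = (\<integral>t. f' t * g' t \<partial>unit_leb)"
    by (intro integral_cong_AE) (auto simp: ae_eq_def square_integrable_def)
qed

definition uminus_l2 :: "l2 \<Rightarrow> l2" where
  "uminus_l2 f = (-1) *\<^sub>R f"

definition minus_l2 :: "l2 \<Rightarrow> l2 \<Rightarrow> l2" where
  "minus_l2 f g = f + - g"

definition norm_l2 :: "l2 \<Rightarrow> real" where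
  "norm_l2 f = sqrt (inner f f)"

definition sgn_l2 :: "l2 \<Rightarrow> l2" where
  "sgn_l2 f = inverse (norm f) *\<^sub>R f"

definition dist_l2 :: "l2 \<Rightarrow> l2 \<Rightarrow> real" where
  "dist_l2 f g = norm (f - g)"

definition uniformity_l2 :: "(l2 \<times> l2) filter" where
  "uniformity_l2 = (INF e\<in>{0<..}. principal {(x, y). dist x y < e})"

definition open_l2 :: "l2 set \<Rightarrow> bool" where
  "open_l2 U \<longleftrightarrow> (\<forall>x\<in>U. eventually (\<lambda>(x', y). x' = x \<longrightarrow> y \<in> U) uniformity)"

instance
proof
  fix f g h :: l2 and a b :: real
  show "f + g + h = f + (g + h)"
    by transfer (auto simp: ae_eq_def add.assoc intro!: square_integrable_add)
  show "f + g = g + f"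
    by transfer (auto simp: ae_eq_def add.commute intro!: square_integrable_add)
  show "0 + f = f"
    by transfer (auto simp: ae_eq_def)
  show "- f + f = 0"
    unfolding uminus_l2_def
  proof transfer
    fix f assume "ae_eq f f"
    then show "ae_eq (\<lambda>t. - 1 * f t + f t) (\<lambda>_. 0)"
      using square_integrable_continuous [of "\<lambda>_. 0"] by (auto simp: ae_eq_def)
  qed
  show "f - g = f + - g"
    by (rule minus_l2_def)
  show "a *\<^sub>R (f + g) = a *\<^sub>R f + a *\<^sub>R g"
    by transfer (auto simp: ae_eq_def distrib_left
        intro!: square_integrable_add square_integrable_scale)
  show "(a + b) *\<^sub>R f = a *\<^sub>R f + b *\<^sub>R f"
    by transfer (auto simp: ae_eq_def distrib_right
        intro!: square_integrable_add square_integrable_scale)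
  show "a *\<^sub>R b *\<^sub>R f = (a * b) *\<^sub>R f"
    by transfer (auto simp: ae_eq_def mult.assoc intro!: square_integrable_scale)
  show "1 *\<^sub>R f = f"
    by transfer (auto simp: ae_eq_def)
  show "sgn f = inverse (norm f) *\<^sub>R f"
    by (rule sgn_l2_def)
  show "dist f g = norm (f - g)"
    by (rule dist_l2_def)
  show "(uniformity :: (l2 \<times> l2) filter) = (INF e\<in>{0<..}. principal {(x, y). dist x y < e})"
    by (rule uniformity_l2_def)
  show "open U \<longleftrightarrow> (\<forall>x\<in>U. eventually (\<lambda>(x', y). x' = x \<longrightarrow> y \<in> U) uniformity)" for U :: "l2 set"
    by (rule open_l2_def)
  show "inner f g = inner g f"
    by transfer (simp add: mult.commute)
  show "inner (f + g) h = inner f h + inner g h"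
    by transfer (auto simp: ae_eq_def distrib_right square_integrable_mult)
  show "inner (a *\<^sub>R f) g = a * inner f g"
    by transfer (simp add: mult.assoc)
  show "0 \<le> inner f f"
    by transfer simp
  show "inner f f = 0 \<longleftrightarrow> f = 0"
  proof transfer
    fix f assume f: "ae_eq f f"
    then have "((\<integral>t. f t * f t \<partial>unit_leb) = 0) \<longleftrightarrow> (AE t in unit_leb. f t * f t = 0)"
      by (intro integral_nonneg_eq_0_iff_AE) (auto simp: ae_eq_def square_integrable_mult)
    with f show "((\<integral>t. f t * f t \<partial>unit_leb) = 0) \<longleftrightarrow> ae_eq f (\<lambda>_. 0)"
      using square_integrable_continuous [of "\<lambda>_. 0"] by (auto simp: ae_eq_def)
  qed
  show "norm f = sqrt (inner f f)"
    by (rule norm_l2_def)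
qed

end

text \<open>\<^term>\<open>abs_l2 f\<close> is the class of \<^term>\<open>f\<close>; it is meaningful for square-integrable
  \<^term>\<open>f\<close> only.\<close>

lemma inner_abs_l2:
  assumes "square_integrable f" "square_integrable g"
  shows "abs_l2 f \<bullet> abs_l2 g = (\<integral>t. f t * g t \<partial>unit_leb)"
  using assms by (intro inner_l2.abs_eq) (auto simp: ae_eq_def)

section \<open>The periodic Sobolev space and its differential operator\<close>

text \<open>Smooth functions on the circle are viewed as 1-periodic smooth functions on the line.
  There is no boundary term in the integration by parts below, and the test functions need not
  vanish at the endpoints, which is what makes the weak derivative the one on the circle.\<close>

definition circle_test :: "(real \<Rightarrow> real) \<Rightarrow> bool" where
  "circle_test p \<longleftrightarrow>
     (\<forall>t. p (t + 1) = p t) \<and> (\<forall>k t. (deriv ^^ k) p differentiable (at t))"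

definition has_weak_deriv :: "l2 \<Rightarrow> l2 \<Rightarrow> bool" where
  "has_weak_deriv f g \<longleftrightarrow>
     (\<forall>p. circle_test p \<longrightarrow> f \<bullet> abs_l2 (deriv p) = - (g \<bullet> abs_l2 p))"

definition sobolev :: "l2 set" where
  "sobolev = {f. \<exists>g. has_weak_deriv f g}"

definition D :: "l2 \<Rightarrow> l2" where
  "D f = (THE g. has_weak_deriv f g)"

definition one_l2 :: l2 where
  "one_l2 = abs_l2 (\<lambda>_. 1)"

definition cos_mode :: "nat \<Rightarrow> l2" where
  "cos_mode j = abs_l2 (\<lambda>t. sqrt 2 * cos (2 * pi * real j * t))"

definition sin_mode :: "nat \<Rightarrow> l2" where
  "sin_mode j = abs_l2 (\<lambda>t. sqrt 2 * sin (2 * pi * real j * t))"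

definition fourier_coeff :: "l2 \<Rightarrow> int \<Rightarrow> complex" where
  "fourier_coeff f k =
     Complex (f \<bullet> abs_l2 (\<lambda>t. cos (2 * pi * of_int k * t)))
             (- (f \<bullet> abs_l2 (\<lambda>t. sin (2 * pi * of_int k * t))))"

lemma trig_deriv:
  "deriv (\<lambda>t. a * cos (c * t) + b * sin (c * t)) =
     (\<lambda>t. (c * b) * cos (c * t) + (- c * a) * sin (c * t :: real))"
  by (intro ext DERIV_imp_deriv) (auto intro!: derivative_eq_intros)

lemma circle_test_trig:
  "circle_test (\<lambda>t. a * cos (2 * pi * of_int k * t) + b * sin (2 * pi * of_int k * t))"
proof -
  let ?c = "2 * pi * real_of_int k"
  let ?p = "\<lambda>a b t. a * cos (?c * t) + b * sin (?c * t)"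
  have "\<exists>a' b'. (deriv ^^ m) (?p a b) = ?p a' b'" for m
  proof (induction m)
    case (Suc m)
    then obtain a' b' where "(deriv ^^ m) (?p a b) = ?p a' b'"
      by blast
    then have "(deriv ^^ Suc m) (?p a b) = ?p (?c * b') (- ?c * a')"
      by (simp only: funpow.simps o_apply trig_deriv)
    then show ?case by blast
  qed auto
  moreover have "?p a' b' differentiable (at t)" for a' b' t
    unfolding real_differentiable_def by (rule exI) (auto intro!: derivative_eq_intros)
  ultimately have "(deriv ^^ m) (?p a b) differentiable (at t)" for m t
    by metis
  moreover have "?p a b (t + 1) = ?p a b t" for t
  proof -
    have "?c * (t + 1) = ?c * t + 2 * pi * of_int k"
      by (simp add: algebra_simps)
    then show ?thesis
      by (simp add: sin_add cos_add)
  qed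
  ultimately show ?thesis
    by (simp add: circle_test_def)
qed

lemma abs_l2_scale:
  assumes "square_integrable f"
  shows "abs_l2 (\<lambda>t. c * f t) = c *\<^sub>R abs_l2 f"
  using assms by (subst scaleR_l2.abs_eq) (auto simp: ae_eq_def)

lemma fourier_coeff_weak_deriv:
  assumes "has_weak_deriv f g"
  shows "fourier_coeff g k = 2 * pi * \<i> * of_int k * fourier_coeff f k"
proof -
  let ?c = "2 * pi * real_of_int k"
  let ?C = "\<lambda>t. cos (?c * t)" and ?S = "\<lambda>t. sin (?c * t)"
  have C: "square_integrable ?C" and S: "square_integrable ?S"
    by (auto intro!: square_integrable_continuous continuous_intros)
  have "deriv ?C = (\<lambda>t. - ?c * ?S t)" "deriv ?S = (\<lambda>t. ?c * ?C t)"
    using trig_deriv [of 1 ?c 0] trig_deriv [of 0 ?c 1] by auto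
  moreover have "circle_test ?C" "circle_test ?S"
    using circle_test_trig [of 1 k 0] circle_test_trig [of 0 k 1] by auto
  ultimately have
    "f \<bullet> abs_l2 (\<lambda>t. - ?c * ?S t) = - (g \<bullet> abs_l2 ?C)"
    "f \<bullet> abs_l2 (\<lambda>t. ?c * ?C t) = - (g \<bullet> abs_l2 ?S)"
    using assms unfolding has_weak_deriv_def by metis+
  then have "g \<bullet> abs_l2 ?C = ?c * (f \<bullet> abs_l2 ?S)" "g \<bullet> abs_l2 ?S = - ?c * (f \<bullet> abs_l2 ?C)"
    unfolding abs_l2_scale [OF C] abs_l2_scale [OF S] by auto
  then show ?thesis
    by (simp add: fourier_coeff_def complex_eq_iff)
qed

section \<open>Singular values\<close>

definition charpoly :: "real ^ 'm ^ 'm \<Rightarrow> real poly" where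
  "charpoly A = det (mat [:0, 1:] - (\<chi> i j. [:A $ i $ j:]))"

text \<open>The singular values are numbered from 1, in decreasing order; \<^term>\<open>proots\<close> counts the
  eigenvalues with their algebraic multiplicity. The value is meaningful for
  \<^term>\<open>k\<close> between 1 and the number of rows.\<close>

definition singular_value :: "real ^ 'n ^ 'd \<Rightarrow> nat \<Rightarrow> real" where
  "singular_value X k =
     rev (sorted_list_of_multiset
       (image_mset sqrt (proots (charpoly (X ** transpose X))))) ! (k - 1)"

section \<open>The minimisation problem\<close>

definition orthonormal_basis_of :: "('i \<Rightarrow> 'v::real_inner) \<Rightarrow> 'i set \<Rightarrow> 'v set \<Rightarrow> bool" where
  "orthonormal_basis_of b I V \<longleftrightarrow>
     (\<forall>i\<in>I. \<forall>j\<in>I. b i \<bullet> b j = (if i = j then 1 else 0)) \<and> span (b ` I) = V"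

definition left_singular_basis :: "real ^ 'n ^ 'd \<Rightarrow> (nat \<Rightarrow> real ^ 'd) \<Rightarrow> bool" where
  "left_singular_basis X u \<longleftrightarrow>
     orthonormal_basis_of u {1..CARD('d)} UNIV \<and>
     (\<forall>k\<in>{1..CARD('d)}. (X ** transpose X) *v u k = (singular_value X k)\<^sup>2 *\<^sub>R u k)"

definition sobolev_isometries :: "(real ^ 'd \<Rightarrow> l2) set" where
  "sobolev_isometries = {\<Phi>. linear \<Phi> \<and> (\<forall>x. norm (\<Phi> x) = norm x) \<and> range \<Phi> \<subseteq> sobolev}"

definition mean_quadratic_variation :: "real ^ 'n ^ 'd \<Rightarrow> (real ^ 'd \<Rightarrow> l2) \<Rightarrow> real" where
  "mean_quadratic_variation X \<Phi> =
     1 / real CARD('n) * (\<Sum>i\<in>UNIV. (norm (D (\<Phi> (column i X))))\<^sup>2)"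

definition mqv_bound :: "real ^ 'n ^ 'd \<Rightarrow> real" where
  "mqv_bound X =
     1 / real CARD('n) *
       (\<Sum>k=2..CARD('d). 4 * pi\<^sup>2 * (real (k div 2))\<^sup>2 * (singular_value X k)\<^sup>2)"

text \<open>Only the \<^term>\<open>\<phi> k\<close> with \<^term>\<open>k\<close> at most the dimension enter \<^term>\<open>\<Phi>\<close>. Requiring a full
  orthonormal pair for every \<^term>\<open>j\<close> is no restriction: every unit vector of the
  two-dimensional span extends to an orthonormal basis of it.\<close>

definition trigonometric_form :: "(nat \<Rightarrow> real ^ 'd) \<Rightarrow> (real ^ 'd \<Rightarrow> l2) \<Rightarrow> bool" where
  "trigonometric_form u \<Phi> \<longleftrightarrow>
     (\<exists>s \<phi>. (s = 1 \<or> s = -1) \<and>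
       (\<forall>j\<ge>1. orthonormal_basis_of \<phi> {2 * j, 2 * j + 1} (span {cos_mode j, sin_mode j})) \<and>
       (\<forall>x. \<Phi> x = (s * (u 1 \<bullet> x)) *\<^sub>R one_l2 + (\<Sum>k=2..CARD('d). (u k \<bullet> x) *\<^sub>R \<phi> k)))"

end

theory Submission
  imports Defs
begin

text \<open>Write \<open>f\<^sub>k = \<Phi>(u\<^sub>k)\<close>. Diagonalising \<open>X X\<^sup>T\<close> turns the objective into
  \<open>1/n * \<Sum>k. \<sigma>\<^sub>k\<^sup>2 * \<parallel>D f\<^sub>k\<parallel>\<^sup>2\<close> with \<open>f\<^sub>1, \<dots>, f\<^sub>d\<close> orthonormal. By Parseval,
  \<open>\<parallel>D f\<parallel>\<^sup>2\<close> is a weighted sum of squared Fourier coefficients, with nondecreasing weights \<open>\<lambda>\<^sub>k = 4 \<pi>\<^sup>2 \<lfloor>k/2\<rfloor>\<^sup>2\<close>,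
  so \<open>\<Sum>k\<le>m. \<parallel>D f\<^sub>k\<parallel>\<^sup>2 \<ge> \<Sum>k\<le>m. \<lambda>\<^sub>k\<close> for every \<open>m\<close> by the Ky Fan argument. Abel summation against the nonincreasing
  \<open>\<sigma>\<^sub>k\<^sup>2\<close> gives the bound. If the \<open>\<sigma>\<^sub>k\<close> are distinct and non-zero, equality forces \<open>\<parallel>D f\<^sub>k\<parallel>\<^sup>2 = \<lambda>\<^sub>k\<close> for
  each \<open>k\<close>; by induction \<open>f\<^sub>k\<close> is orthogonal to all lower frequencies, because the earlier \<open>f\<^sub>i\<close>
  already exhaust them, and so it is a pure wave of frequency \<open>\<lfloor>k/2\<rfloor>\<close>.

  Parseval needs the density of trigonometric polynomials in \<open>L\<^sup>2\<close>: truncation and Luzin-type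
  approximation reduce it to continuous periodic functions, where Stone-Weierstrass on the unit
  circle applies.\<close>

section \<open>Orthonormal families\<close>

definition orthonormal_on :: "('i \<Rightarrow> 'v::real_inner) \<Rightarrow> 'i set \<Rightarrow> bool" where
  "orthonormal_on b I \<longleftrightarrow> (\<forall>i\<in>I. \<forall>j\<in>I. b i \<bullet> b j = (if i = j then 1 else 0))"

lemma orthonormal_onD:
  "orthonormal_on b I \<Longrightarrow> i \<in> I \<Longrightarrow> j \<in> I \<Longrightarrow> b i \<bullet> b j = (if i = j then 1 else 0)"
  by (simp add: orthonormal_on_def)

lemma orthonormal_on_subset: "orthonormal_on b I \<Longrightarrow> J \<subseteq> I \<Longrightarrow> orthonormal_on b J"
  unfolding orthonormal_on_def by blast

lemma orthonormal_basis_of_iff: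
  "orthonormal_basis_of b I V \<longleftrightarrow> orthonormal_on b I \<and> span (b ` I) = V"
  by (simp add: orthonormal_basis_of_def orthonormal_on_def)

lemma inner_sum_orthonormal:
  assumes "orthonormal_on b I" "finite F" "F \<subseteq> I" "k \<in> I"
  shows "(\<Sum>i\<in>F. c i *\<^sub>R b i) \<bullet> b k = (if k \<in> F then c k else 0)"
proof -
  have "(\<Sum>i\<in>F. c i *\<^sub>R b i) \<bullet> b k = (\<Sum>i\<in>F. if i = k then c i else 0)"
    unfolding inner_sum_left using assms
    by (intro sum.cong) (auto simp: orthonormal_onD subset_iff)
  then show ?thesis using assms by simp
qed

lemma inner_sum_sum_orthonormal:
  assumes "orthonormal_on b F" "finite F"
  shows "(\<Sum>i\<in>F. c i *\<^sub>R b i) \<bullet> (\<Sum>i\<in>F. d i *\<^sub>R b i) = (\<Sum>i\<in>F. c i * d i)"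
  unfolding inner_sum_right using inner_sum_orthonormal [OF assms(1,2) order_refl]
  by (simp add: mult.commute)

lemma norm_sum_orthonormal:
  assumes "orthonormal_on b F" "finite F"
  shows "(norm (\<Sum>i\<in>F. c i *\<^sub>R b i))\<^sup>2 = (\<Sum>i\<in>F. (c i)\<^sup>2)"
  unfolding power2_norm_eq_inner inner_sum_sum_orthonormal [OF assms] by (simp add: power2_eq_square)

text \<open>The coefficients \<open>c\<close> are arbitrary: the Fourier coefficients give Bessel's
  inequality, and the non-negative last sum shows that no other choice approximates \<open>f\<close>
  better.\<close>

lemma norm_diff_proj_orthonormal:
  assumes "orthonormal_on b F" "finite F"
  shows "(norm (f - (\<Sum>i\<in>F. c i *\<^sub>R b i)))\<^sup>2 =
    (norm f)\<^sup>2 - (\<Sum>i\<in>F. (f \<bullet> b i)\<^sup>2) + (\<Sum>i\<in>F. (f \<bullet> b i - c i)\<^sup>2)"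
proof -
  define p where "p = (\<Sum>i\<in>F. c i *\<^sub>R b i)"
  have "(norm (f - p))\<^sup>2 = (norm f)\<^sup>2 - 2 * (f \<bullet> p) + (norm p)\<^sup>2"
    by (simp add: power2_norm_eq_inner inner_diff_left inner_diff_right inner_commute [of p f])
  moreover have "f \<bullet> p = (\<Sum>i\<in>F. c i * (f \<bullet> b i))"
    by (simp add: p_def inner_sum_right)
  moreover have "(norm p)\<^sup>2 = (\<Sum>i\<in>F. (c i)\<^sup>2)"
    unfolding p_def by (rule norm_sum_orthonormal [OF assms])
  moreover have "(\<Sum>i\<in>F. (f \<bullet> b i - c i)\<^sup>2) =
      (\<Sum>i\<in>F. (f \<bullet> b i)\<^sup>2) - 2 * (\<Sum>i\<in>F. c i * (f \<bullet> b i)) + (\<Sum>i\<in>F. (c i)\<^sup>2)"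
    by (simp add: power2_diff sum.distrib sum_subtractf sum_distrib_left mult_ac)
  ultimately show ?thesis unfolding p_def by simp
qed

lemma bessel_inequality:
  assumes "orthonormal_on b F" "finite F"
  shows "(\<Sum>i\<in>F. (f \<bullet> b i)\<^sup>2) \<le> (norm f)\<^sup>2"
proof -
  have "0 \<le> (norm (f - (\<Sum>i\<in>F. (f \<bullet> b i) *\<^sub>R b i)))\<^sup>2" by simp
  then show ?thesis unfolding norm_diff_proj_orthonormal [OF assms] by simp
qed

text \<open>Coefficients are attached to indices instead of vectors, so that they can be compared
  with \<open>f \<bullet> b i\<close> and padded with zeros over a larger index set.\<close>

lemma span_image_finite_sum:
  assumes "g \<in> span (b ` I)"
  obtains F c where "finite F" "F \<subseteq> I" "g = (\<Sum>i\<in>F. c i *\<^sub>R b i)"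
proof -
  have "\<exists>F c. finite F \<and> F \<subseteq> I \<and> g = (\<Sum>i\<in>F. c i *\<^sub>R b i)"
    using assms
  proof (induction rule: span_induct_alt)
    case base
    then show ?case by (intro exI [of _ "{}"]) auto
  next
    case (step c x y)
    then obtain k F d where k: "k \<in> I" "x = b k" and F: "finite F" "F \<subseteq> I" "y = (\<Sum>i\<in>F. d i *\<^sub>R b i)"
      by blast
    have "c *\<^sub>R x = (\<Sum>i\<in>insert k F. (if i = k then c else 0) *\<^sub>R b i)"
      using k F by (simp add: if_distrib [of "\<lambda>r. r *\<^sub>R _"] cong: if_cong)
    moreover have "y = (\<Sum>i\<in>insert k F. (if i \<in> F then d i else 0) *\<^sub>R b i)"
      using F by (auto simp: insert_absorb sum.insert_if intro!: sum.cong)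
    ultimately have "c *\<^sub>R x + y = (\<Sum>i\<in>insert k F. ((if i = k then c else 0) + (if i \<in> F then d i else 0)) *\<^sub>R b i)"
      by (simp only: scaleR_left_distrib sum.distrib)
    with k F show ?case
      by (intro exI [of _ "insert k F"] exI [of _ "\<lambda>i. (if i = k then c else 0) + (if i \<in> F then d i else 0)"]) simp
  qed
  with that show thesis by blast
qed

lemma expansion_orthonormal:
  assumes "orthonormal_on b I" "finite I" "f \<in> span (b ` I)"
  shows "f = (\<Sum>i\<in>I. (f \<bullet> b i) *\<^sub>R b i)"
proof -
  obtain F c where F: "finite F" "F \<subseteq> I" "f = (\<Sum>i\<in>F. c i *\<^sub>R b i)"
    using span_image_finite_sum [OF assms(3)] .
  have "(\<Sum>i\<in>I. (f \<bullet> b i) *\<^sub>R b i) = (\<Sum>i\<in>I. if i \<in> F then c i *\<^sub>R b i else 0)"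
    using F inner_sum_orthonormal [OF assms(1) F(1,2)] by (intro sum.cong) auto
  also have "\<dots> = f"
    using F assms(2) by (simp add: sum.If_cases Int_absorb1)
  finally show ?thesis ..
qed

text \<open>A combination \<open>g\<close> of the family lies within \<open>sqrt e\<close> of
  \<open>f\<close>. Projecting onto any finite index set that contains the indices of
  \<open>g\<close> is at least as accurate, so the missing mass is below \<open>e\<close>; Bessel's
  inequality gives its sign.\<close>

lemma parseval_has_sum:
  assumes b: "orthonormal_on b I" and f: "f \<in> closure (span (b ` I))"
  shows "((\<lambda>i. (f \<bullet> b i)\<^sup>2) has_sum (norm f)\<^sup>2) I"
  unfolding has_sum_def
proof (rule tendstoI)
  fix e :: real assume "e > 0"
  then obtain g where g: "g \<in> span (b ` I)" "dist g f < sqrt e"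
    using f closure_approachable [of f "span (b ` I)"] by (metis real_sqrt_gt_zero)
  obtain F0 c where F0: "finite F0" "F0 \<subseteq> I" "g = (\<Sum>i\<in>F0. c i *\<^sub>R b i)"
    using span_image_finite_sum [OF g(1)] .
  show "\<forall>\<^sub>F F in finite_subsets_at_top I. dist (\<Sum>i\<in>F. (f \<bullet> b i)\<^sup>2) ((norm f)\<^sup>2) < e"
    unfolding eventually_finite_subsets_at_top
  proof (intro exI [of _ F0] conjI allI impI)
    fix F assume F: "finite F \<and> F0 \<subseteq> F \<and> F \<subseteq> I"
    then have on: "orthonormal_on b F" using b orthonormal_on_subset by blast
    have "g = (\<Sum>i\<in>F. (if i \<in> F0 then c i else 0) *\<^sub>R b i)"
      using F F0 by (simp add: if_distrib [of "\<lambda>r. r *\<^sub>R _"] sum.If_cases Int_absorb1 cong: if_cong)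
    then have "(norm f)\<^sup>2 - (\<Sum>i\<in>F. (f \<bullet> b i)\<^sup>2) \<le> (norm (f - g))\<^sup>2"
      using norm_diff_proj_orthonormal [OF on] F by (simp add: sum_nonneg)
    moreover have "norm (f - g) < sqrt e"
      using g(2) by (simp add: dist_norm norm_minus_commute)
    then have "(norm (f - g))\<^sup>2 < (sqrt e)\<^sup>2"
      by (intro power_strict_mono) auto
    ultimately show "dist (\<Sum>i\<in>F. (f \<bullet> b i)\<^sup>2) ((norm f)\<^sup>2) < e"
      using bessel_inequality [OF on, of f] F \<open>e > 0\<close> by (simp add: dist_real_def)
  qed (use F0 in auto)
qed

text \<open>Parseval makes the norm of \<open>f\<close> equal to that of its projection onto the
  span of the \<open>b i\<close> with \<open>i\<close> in \<open>F\<close>, so the projection error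
  is zero.\<close>

lemma eq_sum_of_coeffs_zero:
  assumes b: "orthonormal_on b I" and f: "f \<in> closure (span (b ` I))"
    and F: "finite F" "F \<subseteq> I" "\<And>i. i \<in> I - F \<Longrightarrow> f \<bullet> b i = 0"
  shows "f = (\<Sum>i\<in>F. (f \<bullet> b i) *\<^sub>R b i)"
proof -
  have "((\<lambda>i. (f \<bullet> b i)\<^sup>2) has_sum (\<Sum>i\<in>F. (f \<bullet> b i)\<^sup>2)) I"
    using F by (intro has_sum_finite_neutralI) auto
  with parseval_has_sum [OF b f] have "(norm f)\<^sup>2 = (\<Sum>i\<in>F. (f \<bullet> b i)\<^sup>2)"
    using has_sum_unique by blast
  then have "(norm (f - (\<Sum>i\<in>F. (f \<bullet> b i) *\<^sub>R b i)))\<^sup>2 = 0"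
    using norm_diff_proj_orthonormal [of b F f] orthonormal_on_subset [OF b F(2)] F(1) by simp
  then show ?thesis by simp
qed

section \<open>Density of trigonometric polynomials\<close>

lemma l2_cases:
  obtains g where "square_integrable g" "f = abs_l2 g"
proof -
  have "\<exists>g. square_integrable g \<and> f = abs_l2 g"
    by (induction f rule: l2.abs_induct) (auto simp: ae_eq_def)
  then show thesis using that by blast
qed

lemma square_integrable_diff:
  assumes "square_integrable f" "square_integrable g"
  shows "square_integrable (\<lambda>t. f t - g t)"
  using square_integrable_add [OF assms(1) square_integrable_scale [OF assms(2), of "-1"]] by simp

lemma abs_l2_add:
  assumes "square_integrable f" "square_integrable g"
  shows "abs_l2 (\<lambda>t. f t + g t) = abs_l2 f + abs_l2 g"
  using assms by (subst plus_l2.abs_eq) (auto simp: ae_eq_def)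

lemma abs_l2_diff:
  assumes "square_integrable f" "square_integrable g"
  shows "abs_l2 (\<lambda>t. f t - g t) = abs_l2 f - abs_l2 g"
  using abs_l2_add [OF assms(1) square_integrable_scale [OF assms(2), of "-1"]]
    abs_l2_scale [OF assms(2), of "-1"] by simp

lemma norm_abs_l2:
  assumes "square_integrable f"
  shows "(norm (abs_l2 f))\<^sup>2 = (\<integral>t. (f t)\<^sup>2 \<partial>unit_leb)"
  unfolding power2_norm_eq_inner inner_abs_l2 [OF assms assms] by (simp add: power2_eq_square)

lemma AE_unit_lebI: "(\<And>t. t \<in> {0..1} \<Longrightarrow> P t) \<Longrightarrow> AE t in unit_leb. P t"
  by (intro AE_I2) simp

lemma AE_unit_leb_negligible:
  assumes "negligible N" "\<And>t. t \<in> {0..1} \<Longrightarrow> t \<notin> N \<Longrightarrow> P t"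
  shows "AE t in unit_leb. P t"
proof -
  have "AE t in lebesgue. t \<in> {0..1} \<longrightarrow> P t"
    unfolding eventually_ae_filter_negligible using assms by blast
  then show ?thesis
    by (subst AE_restrict_space_iff) auto
qed

text \<open>Dominated convergence applied to the squared errors. The term \<open>|f|\<close> enters
  the majorant because the bound by \<open>w\<close> is given for the approximants only.\<close>

lemma l2_dominated_convergence:
  assumes f: "square_integrable f" and g: "\<And>n. square_integrable (g n)" and w: "square_integrable w"
    and lim: "AE t in unit_leb. (\<lambda>n. g n t) \<longlonglongrightarrow> f t"
    and bound: "\<And>n. AE t in unit_leb. \<bar>g n t\<bar> \<le> w t"
  shows "(\<lambda>n. abs_l2 (g n)) \<longlonglongrightarrow> abs_l2 f"
proof -
  have fabs: "square_integrable (\<lambda>t. \<bar>f t\<bar>)"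
    using f by (auto simp: square_integrable_def)
  have "(\<lambda>n. \<integral>t. (g n t - f t)\<^sup>2 \<partial>unit_leb) \<longlonglongrightarrow> (\<integral>t. 0 \<partial>unit_leb)"
  proof (rule integral_dominated_convergence)
    show "integrable unit_leb (\<lambda>t. (w t + \<bar>f t\<bar>)\<^sup>2)"
      using square_integrable_add [OF w fabs] by (simp add: square_integrable_def)
    show "AE t in unit_leb. (\<lambda>n. (g n t - f t)\<^sup>2) \<longlonglongrightarrow> 0"
      using lim
    proof eventually_elim
      case (elim t)
      then have "(\<lambda>n. (g n t - f t)\<^sup>2) \<longlonglongrightarrow> (f t - f t)\<^sup>2"
        by (intro tendsto_intros)
      then show ?case by simp
    qed
    show "AE t in unit_leb. norm ((g n t - f t)\<^sup>2) \<le> (w t + \<bar>f t\<bar>)\<^sup>2" for n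
      using bound [of n]
    proof eventually_elim
      case (elim t)
      then have "\<bar>g n t - f t\<bar> \<le> w t + \<bar>f t\<bar>" by linarith
      then have "\<bar>g n t - f t\<bar>\<^sup>2 \<le> (w t + \<bar>f t\<bar>)\<^sup>2" by (rule power_mono) simp
      then show ?case by simp
    qed
    show "(\<lambda>t. (g n t - f t)\<^sup>2) \<in> borel_measurable unit_leb" for n
      using square_integrable_diff [OF g [of n] f]
      by (intro borel_measurable_integrable) (simp add: square_integrable_def)
  qed simp
  moreover have "(\<integral>t. (g n t - f t)\<^sup>2 \<partial>unit_leb) = (norm (abs_l2 (g n) - abs_l2 f))\<^sup>2" for n
    by (simp add: norm_abs_l2 [OF square_integrable_diff [OF g f]] flip: abs_l2_diff [OF g f])
  ultimately have "(\<lambda>n. sqrt ((norm (abs_l2 (g n) - abs_l2 f))\<^sup>2)) \<longlonglongrightarrow> sqrt 0"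
    by (intro tendsto_real_sqrt) simp
  then show ?thesis
    by (simp add: LIM_zero_iff tendsto_norm_zero_iff)
qed

section \<open>Trigonometric polynomials: closure under products and uniform approximation\<close>

inductive trig_poly :: "(real \<Rightarrow> real) \<Rightarrow> bool" where
  cos: "trig_poly (\<lambda>t. c * cos (2 * pi * of_int k * t))"
| sin: "trig_poly (\<lambda>t. c * sin (2 * pi * of_int k * t))"
| add: "trig_poly p \<Longrightarrow> trig_poly q \<Longrightarrow> trig_poly (\<lambda>t. p t + q t)"

lemma trig_poly_const: "trig_poly (\<lambda>_. c)"
  using trig_poly.cos [of c 0] by simp

text \<open>Product-to-sum formulas. Frequencies range over the integers so that
  \<open>k - l\<close> is always available.\<close>

lemma trig_poly_mult_modes:
  "trig_poly (\<lambda>t. a * cos (2 * pi * of_int k * t) * (b * cos (2 * pi * of_int l * t)))"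
  "trig_poly (\<lambda>t. a * cos (2 * pi * of_int k * t) * (b * sin (2 * pi * of_int l * t)))"
  "trig_poly (\<lambda>t. a * sin (2 * pi * of_int k * t) * (b * cos (2 * pi * of_int l * t)))"
  "trig_poly (\<lambda>t. a * sin (2 * pi * of_int k * t) * (b * sin (2 * pi * of_int l * t)))"
proof -
  define x where "x i t = 2 * pi * of_int i * t" for i :: int and t :: real
  have x: "x (k - l) t = x k t - x l t" "x (k + l) t = x k t + x l t" for t
    by (simp_all add: x_def algebra_simps)
  note c = trig_poly.cos [folded x_def] and s = trig_poly.sin [folded x_def]
  have "trig_poly (\<lambda>t. a * cos (x k t) * (b * cos (x l t)))"
    using trig_poly.add [OF c [of "a * b / 2" "k - l"] c [of "a * b / 2" "k + l"]]
    by (simp add: x cos_add cos_diff algebra_simps)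
  moreover have "trig_poly (\<lambda>t. a * cos (x k t) * (b * sin (x l t)))"
    using trig_poly.add [OF s [of "- a * b / 2" "k - l"] s [of "a * b / 2" "k + l"]]
    by (simp add: x sin_add sin_diff algebra_simps)
  moreover have "trig_poly (\<lambda>t. a * sin (x k t) * (b * cos (x l t)))"
    using trig_poly.add [OF s [of "a * b / 2" "k - l"] s [of "a * b / 2" "k + l"]]
    by (simp add: x sin_add sin_diff algebra_simps)
  moreover have "trig_poly (\<lambda>t. a * sin (x k t) * (b * sin (x l t)))"
    using trig_poly.add [OF c [of "a * b / 2" "k - l"] c [of "- a * b / 2" "k + l"]]
    by (simp add: x cos_add cos_diff algebra_simps)
  ultimately show
    "trig_poly (\<lambda>t. a * cos (2 * pi * of_int k * t) * (b * cos (2 * pi * of_int l * t)))"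
    "trig_poly (\<lambda>t. a * cos (2 * pi * of_int k * t) * (b * sin (2 * pi * of_int l * t)))"
    "trig_poly (\<lambda>t. a * sin (2 * pi * of_int k * t) * (b * cos (2 * pi * of_int l * t)))"
    "trig_poly (\<lambda>t. a * sin (2 * pi * of_int k * t) * (b * sin (2 * pi * of_int l * t)))"
    by (simp_all only: x_def)
qed

lemma trig_poly_mult:
  assumes "trig_poly p" "trig_poly q"
  shows "trig_poly (\<lambda>t. p t * q t)"
  using assms
proof (induction p)
  case (cos a k)
  from cos.prems show ?case
  proof (induction q)
    case (add p q)
    then show ?case using trig_poly.add [OF add.IH] by (simp add: distrib_left)
  qed (rule trig_poly_mult_modes)+
next
  case (sin a k)
  from sin.prems show ?case
  proof (induction q)
    case (add p q)
    then show ?case using trig_poly.add [OF add.IH] by (simp add: distrib_left)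
  qed (rule trig_poly_mult_modes)+
next
  case (add p p')
  then show ?case using trig_poly.add [OF add.IH(1) add.IH(2)] by (simp add: distrib_right)
qed

text \<open>On the unit circle a real-linear functional is a combination of the cosine and sine of
  frequency 1, and constants, sums and products stay trigonometric. This links the Stone-Weierstrass
  theorem to Fourier modes.\<close>

lemma trig_poly_polynomial_on_circle:
  fixes g :: "complex \<Rightarrow> real"
  assumes "real_polynomial_function g"
  shows "trig_poly (\<lambda>t. g (cis (2 * pi * t)))"
  using assms
proof (induction g)
  case (linear g)
  interpret bounded_linear g by fact
  have "g (cis (2 * pi * t)) = g 1 * cos (2 * pi * of_int 1 * t) + g \<i> * sin (2 * pi * of_int 1 * t)" for t
  proof -
    have "cis (2 * pi * t) = cos (2 * pi * t) *\<^sub>R 1 + sin (2 * pi * t) *\<^sub>R \<i>"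
      by (simp add: complex_eq_iff)
    then show ?thesis by (simp only: add scaleR) simp
  qed
  then show ?case by (simp only: trig_poly.intros)
qed (auto intro: trig_poly_const trig_poly.add trig_poly_mult)

lemma trig_poly_continuous: "trig_poly p \<Longrightarrow> continuous_on S p"
  by (induction rule: trig_poly.induct) (auto intro!: continuous_intros)

lemma trig_poly_approx_periodic:
  fixes h :: "real \<Rightarrow> real"
  assumes h: "continuous_on {0..1} h" "h 0 = h 1" and e: "e > 0"
  obtains p where "trig_poly p" "\<And>t. t \<in> {0..1} \<Longrightarrow> \<bar>h t - p t\<bar> < e"
proof -
  define q :: "real \<Rightarrow> complex" where "q t = cis (2 * pi * t)" for t
  define H where "H z = h (Arg2pi z / (2 * pi))" for z
  have cq: "continuous_on A q" for A
    unfolding q_def by (intro continuous_intros)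
  have Hq: "H (q t) = h t" if "t \<in> {0..1}" for t
  proof (cases "t = 1")
    case True
    \<comment> \<open>At \<open>t = 1\<close> the angle wraps round to 0; this is where
      \<open>h 0 = h 1\<close> enters.\<close>
    moreover have "Arg2pi 1 = 0" by (rule Arg2pi_unique [of 1]) auto
    ultimately show ?thesis by (simp add: H_def q_def h(2))
  next
    case False
    then have "Arg2pi (q t) = 2 * pi * t"
      unfolding q_def using that by (intro Arg2pi_unique [of 1]) (auto simp: cis_conv_exp)
    then show ?thesis by (simp add: H_def)
  qed
  let ?S = "q ` {0..1}"
  have S: "compact ?S" by (intro compact_continuous_image cq compact_Icc)
  \<comment> \<open>\<open>Arg2pi\<close> jumps at 1, so \<open>H\<close> is not handled as a
    composition. Instead \<open>q\<close> maps the compact interval onto the circle, and the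
    preimage of a closed set under \<open>H\<close> is the \<open>q\<close>-image of its compact
    preimage under \<open>h\<close>.\<close>
  have "continuous_on ?S H"
  proof (subst continuous_on_closed_vimage)
    show "closed ?S" using S by (rule compact_imp_closed)
    show "\<forall>B. closed B \<longrightarrow> closed (H -` B \<inter> ?S)"
    proof (intro allI impI)
      fix B :: "real set" assume "closed B"
      then have "closed (h -` B \<inter> {0..1})"
        using h(1) continuous_on_closed_vimage [of "{0..1::real}" h] by auto
      then have "compact (h -` B \<inter> {0..1})"
        by (rule closed_Int_compact [THEN back_subst [of compact]]) auto
      then have "compact (q ` (h -` B \<inter> {0..1}))"
        by (intro compact_continuous_image cq)
      also have "q ` (h -` B \<inter> {0..1}) = H -` B \<inter> ?S"
        using Hq by auto
      finally show "closed (H -` B \<inter> ?S)" by (rule compact_imp_closed)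
    qed
  qed
  then obtain g where g: "real_polynomial_function g" "\<And>z. z \<in> ?S \<Longrightarrow> \<bar>H z - g z\<bar> < e"
    using Stone_Weierstrass_real_polynomial_function [OF S _ e] by blast
  show thesis
  proof (rule that)
    show "trig_poly (\<lambda>t. g (q t))"
      unfolding q_def by (rule trig_poly_polynomial_on_circle [OF g(1)])
    show "\<bar>h t - g (q t)\<bar> < e" if "t \<in> {0..1}" for t
      using g(2) [of "q t"] Hq [OF that] that by auto
  qed
qed

lemma measure_unit_leb: "measure unit_leb (space unit_leb) = 1"
  by (simp add: measure_restrict_space)

text \<open>Three stages enlarge what is known to lie in \<open>V\<close>: continuous functions with
  equal endpoint values, then bounded functions, then all. Each stage only takes limits, so
  \<open>V\<close> is a closed set rather than a subspace.\<close>

lemma dense_l2_trig_poly: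
  fixes V :: "l2 set"
  assumes V: "closed V" and trig: "\<And>p. trig_poly p \<Longrightarrow> abs_l2 p \<in> V"
  shows "V = UNIV"
proof -
  have cont: "abs_l2 h \<in> V" if h: "continuous_on UNIV h" "h 0 = h 1" for h
  proof -
    have "abs_l2 h \<in> closure V"
      unfolding closure_approachable
    proof (intro allI impI)
      fix e :: real assume "e > 0"
      \<comment> \<open>Half of \<open>e\<close>, since integrating the pointwise bound leaves only
        a non-strict inequality.\<close>
      obtain p where p: "trig_poly p" "\<And>t. t \<in> {0..1} \<Longrightarrow> \<bar>h t - p t\<bar> < e / 2"
        using trig_poly_approx_periodic [of h "e / 2"] h continuous_on_subset \<open>e > 0\<close>
        by (metis half_gt_zero subset_UNIV)
      have sq: "square_integrable p" "square_integrable h"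
        using h trig_poly_continuous [OF p(1)] by (auto intro: square_integrable_continuous)
      have pos: "0 < e / 2" using \<open>e > 0\<close> by simp
      have "(norm (abs_l2 h - abs_l2 p))\<^sup>2 = (\<integral>t. (h t - p t)\<^sup>2 \<partial>unit_leb)"
        by (simp add: norm_abs_l2 square_integrable_diff sq flip: abs_l2_diff)
      also have "\<dots> \<le> (\<integral>t. (e / 2)\<^sup>2 \<partial>unit_leb)"
      proof (rule integral_mono_AE)
        show "integrable unit_leb (\<lambda>t. (h t - p t)\<^sup>2)"
          using square_integrable_diff [OF sq(2,1)] by (simp add: square_integrable_def)
        show "AE t in unit_leb. (h t - p t)\<^sup>2 \<le> (e / 2)\<^sup>2"
        proof (rule AE_unit_lebI)
          fix t :: real assume "t \<in> {0..1}"
          then show "(h t - p t)\<^sup>2 \<le> (e / 2)\<^sup>2"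
            using p(2) [of t] pos by (intro abs_le_square_iff [THEN iffD1]) auto
        qed
      qed simp
      also have "\<dots> = (e / 2)\<^sup>2"
        using measure_unit_leb by simp
      finally have "norm (abs_l2 h - abs_l2 p) \<le> e / 2"
        using pos by (simp add: abs_le_square_iff [symmetric])
      with \<open>e > 0\<close> have "dist (abs_l2 p) (abs_l2 h) < e"
        by (simp add: dist_norm norm_minus_commute)
      with trig [OF p(1)] show "\<exists>y\<in>V. dist y (abs_l2 h) < e" by blast
    qed
    then show ?thesis using V by simp
  qed
  have bounded: "abs_l2 f \<in> V" if f: "square_integrable f" "\<And>t. \<bar>f t\<bar> \<le> M" for f M
  proof -
    \<comment> \<open>This notion of measurability supplies continuous functions converging to
      \<open>f\<close> off a negligible set. They need not be bounded, hence the clamping between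
      \<open>-M\<close> and \<open>M\<close> below.\<close>
    have "f measurable_on {0..1}"
      using f by (simp add: square_integrable_def measurable_on_iff_borel_measurable)
    then obtain N g where N: "negligible N" and g: "\<And>n. continuous_on UNIV (g n)"
      "\<And>t. t \<notin> N \<Longrightarrow> (\<lambda>n. g n t) \<longlonglongrightarrow> (if t \<in> {0..1} then f t else 0)"
      unfolding measurable_on_def by blast
    text \<open>The cut-off factor makes \<open>h n\<close> vanish at both endpoints, hence periodic.\<close>
    define h where "h n t = max (-M) (min M (g n t)) * min 1 (real n * (t * (1 - t)))" for n :: nat and t
    have M: "0 \<le> M" using f(2) [of 0] by simp
    have h: "continuous_on UNIV (h n)" for n
      unfolding h_def by (intro continuous_intros g)
    have "(\<lambda>n. abs_l2 (h n)) \<longlonglongrightarrow> abs_l2 f"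
    proof (rule l2_dominated_convergence)
      show "square_integrable (\<lambda>_. M)" "square_integrable (h n)" for n
        using h by (auto intro: square_integrable_continuous)
      show "AE t in unit_leb. \<bar>h n t\<bar> \<le> M" for n
      proof (rule AE_unit_lebI)
        fix t :: real assume "t \<in> {0..1}"
        then have "0 \<le> real n * (t * (1 - t))" by simp
        then have "\<bar>min 1 (real n * (t * (1 - t)))\<bar> \<le> 1" by linarith
        moreover have "\<bar>max (-M) (min M (g n t))\<bar> \<le> M" using M by linarith
        ultimately show "\<bar>h n t\<bar> \<le> M"
          unfolding h_def abs_mult using mult_mono [of _ M _ 1] M by fastforce
      qed
      \<comment> \<open>The endpoints join the exceptional set because the cut-off factor is 0 there
        for every \<open>n\<close>.\<close>
      show "AE t in unit_leb. (\<lambda>n. h n t) \<longlonglongrightarrow> f t"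
      proof (rule AE_unit_leb_negligible [of "N \<union> {0, 1}"])
        show "negligible (N \<union> {0, 1})" using N by simp
        fix t :: real assume t: "t \<in> {0..1}" "t \<notin> N \<union> {0, 1}"
        then have pos: "0 < t * (1 - t)" by auto
        have "(\<lambda>n. min 1 (real n * (t * (1 - t)))) \<longlonglongrightarrow> 1"
        proof (rule tendsto_eventually)
          have "eventually (\<lambda>n. real n \<ge> 1 / (t * (1 - t))) sequentially"
            using filterlim_real_sequentially by (simp add: filterlim_at_top)
          then show "\<forall>\<^sub>F n in sequentially. min 1 (real n * (t * (1 - t))) = 1"
            by eventually_elim (use pos in \<open>simp add: field_simps min_def\<close>)
        qed
        moreover have "(\<lambda>n. max (-M) (min M (g n t))) \<longlonglongrightarrow> max (-M) (min M (f t))"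
          using g(2) [of t] t by (intro tendsto_intros) auto
        moreover have "max (-M) (min M (f t)) = f t"
          using f(2) [of t] by linarith
        ultimately show "(\<lambda>n. h n t) \<longlonglongrightarrow> f t"
          unfolding h_def using tendsto_mult by fastforce
      qed
    qed (rule f)
    then show ?thesis
      by (rule closed_sequentially [OF V, rotated]) (auto simp: h_def intro!: cont h)
  qed
  have "f \<in> V" for f
  proof -
    obtain g where g: "square_integrable g" "f = abs_l2 g" by (rule l2_cases)
    \<comment> \<open>Truncating at height \<open>n\<close> makes each \<open>h n\<close> bounded,
      while \<open>|g|\<close> dominates them all.\<close>
    define h where "h n t = max (- real n) (min (real n) (g t))" for n :: nat and t
    have le: "\<bar>h n t\<bar> \<le> \<bar>g t\<bar>" for n t unfolding h_def by linarith
    have h: "square_integrable (h n)" for n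
    proof -
      have m: "h n \<in> borel_measurable unit_leb"
        unfolding h_def using g by (auto simp: square_integrable_def)
      moreover have "integrable unit_leb (\<lambda>t. (h n t)\<^sup>2)"
      proof (rule Bochner_Integration.integrable_bound)
        show "integrable unit_leb (\<lambda>t. (g t)\<^sup>2)" using g by (simp add: square_integrable_def)
        show "AE t in unit_leb. norm ((h n t)\<^sup>2) \<le> norm ((g t)\<^sup>2)"
          using le by (simp add: abs_le_square_iff)
      qed (use m in auto)
      ultimately show ?thesis by (simp add: square_integrable_def)
    qed
    have "(\<lambda>n. abs_l2 (h n)) \<longlonglongrightarrow> abs_l2 g"
    proof (rule l2_dominated_convergence [OF g(1) h])
      show "square_integrable (\<lambda>t. \<bar>g t\<bar>)" using g by (auto simp: square_integrable_def)
      show "AE t in unit_leb. (\<lambda>n. h n t) \<longlonglongrightarrow> g t"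
      proof (rule AE_unit_lebI, rule tendsto_eventually)
        fix t
        have "eventually (\<lambda>n. real n \<ge> \<bar>g t\<bar>) sequentially"
          using filterlim_real_sequentially by (simp add: filterlim_at_top)
        then show "\<forall>\<^sub>F n in sequentially. h n t = g t"
          by eventually_elim (unfold h_def, linarith)
      qed
    qed (use le in simp)
    moreover have "abs_l2 (h n) \<in> V" for n
      by (rule bounded [OF h, of n "real n"]) (simp add: h_def)
    ultimately show ?thesis unfolding g(2) using closed_sequentially [OF V, of "\<lambda>n. abs_l2 (h n)"] by simp
  qed
  then show ?thesis by blast
qed

section \<open>Fourier modes and weak derivatives\<close>

text \<open>The fundamental theorem of calculus on the circle. It yields both the orthogonality
  relations and integration by parts without a boundary term.\<close>

lemma integral_deriv_periodic:
  assumes "\<And>t. (p has_real_derivative p' t) (at t)" "continuous_on UNIV p'" "p 1 = p 0"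
  shows "(\<integral>t. p' t \<partial>unit_leb) = 0"
proof -
  have "(p' has_integral p 1 - p 0) {0..1}"
    using assms(1)
    by (intro fundamental_theorem_of_calculus)
       (auto simp: has_real_derivative_iff_has_vector_derivative [symmetric] intro: has_field_derivative_at_within)
  moreover have "integrable unit_leb p'"
    using assms(2) continuous_on_subset by (intro continuous_imp_integrable_real) auto
  ultimately show ?thesis
    using assms(3) lebesgue_integral_eq_integral [of "{0..1}" p'] by (simp add: integral_unique)
qed

section \<open>Orthogonality and completeness of the trigonometric system\<close>

lemma integral_cos_unit: "(\<integral>t. cos (2 * pi * of_int k * t) \<partial>unit_leb) = (if k = 0 then 1 else 0)"
proof (cases "k = 0")
  case True
  then show ?thesis using measure_unit_leb by simp
next
  case False
  define c where "c = 2 * pi * real_of_int k"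
  have "(\<integral>t. cos (c * t) \<partial>unit_leb) = 0"
  proof (rule integral_deriv_periodic)
    show "((\<lambda>t. sin (c * t) / c) has_real_derivative cos (c * t)) (at t)" for t
      using False by (auto intro!: derivative_eq_intros simp: c_def)
    show "continuous_on UNIV (\<lambda>t. cos (c * t))" by (intro continuous_intros)
    show "sin (c * 1) / c = sin (c * 0) / c"
      by (simp add: c_def)
  qed
  with False show ?thesis by (simp add: c_def)
qed

lemma integral_sin_unit: "(\<integral>t. sin (2 * pi * of_int k * t) \<partial>unit_leb) = 0"
proof (cases "k = 0")
  case False
  define c where "c = 2 * pi * real_of_int k"
  have "(\<integral>t. sin (c * t) \<partial>unit_leb) = 0"
  proof (rule integral_deriv_periodic)
    show "((\<lambda>t. - cos (c * t) / c) has_real_derivative sin (c * t)) (at t)" for t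
      using False by (auto intro!: derivative_eq_intros simp: c_def)
    show "continuous_on UNIV (\<lambda>t. sin (c * t))" by (intro continuous_intros)
    show "- cos (c * 1) / c = - cos (c * 0) / c"
      by (simp add: c_def)
  qed
  then show ?thesis by (simp add: c_def)
qed simp

text \<open>Unnormalised and indexed by integers, unlike \<open>cos_mode\<close>: product-to-sum
  formulas produce negative frequencies, and \<open>fourier_coeff\<close> is built from exactly
  these functions.\<close>

definition cos_wave :: "int \<Rightarrow> l2" where
  "cos_wave k = abs_l2 (\<lambda>t. cos (2 * pi * of_int k * t))"

definition sin_wave :: "int \<Rightarrow> l2" where
  "sin_wave k = abs_l2 (\<lambda>t. sin (2 * pi * of_int k * t))"

lemma square_integrable_waves:
  "square_integrable (\<lambda>t. cos (2 * pi * of_int k * t))"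
  "square_integrable (\<lambda>t. sin (2 * pi * of_int k * t))"
  by (auto intro!: square_integrable_continuous continuous_intros)

text \<open>Both \<open>k = l\<close> and \<open>k = - l\<close> contribute, since opposite integers
  give the same wave up to sign. At frequency 0 the two terms add up to 1 for the cosine and cancel
  for the sine.\<close>

lemma wave_inner:
  "cos_wave k \<bullet> cos_wave l = ((if k = l then 1 else 0) + (if k = - l then 1 else 0)) / 2"
  "sin_wave k \<bullet> sin_wave l = ((if k = l then 1 else 0) - (if k = - l then 1 else 0)) / 2"
  "sin_wave k \<bullet> cos_wave l = 0"
proof -
  define x where "x i t = 2 * pi * of_int i * t" for i :: int and t :: real
  have x: "x k t - x l t = x (k - l) t" "x k t + x l t = x (k + l) t" for t
    by (simp_all add: x_def algebra_simps)
  have int: "integrable unit_leb (\<lambda>t. cos (x i t))" "integrable unit_leb (\<lambda>t. sin (x i t))" for i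
    unfolding x_def by (auto intro!: continuous_imp_integrable_real continuous_intros)
  have I: "(\<integral>t. cos (x i t) \<partial>unit_leb) = (if i = 0 then 1 else 0)" "(\<integral>t. sin (x i t) \<partial>unit_leb) = 0" for i
    unfolding x_def by (rule integral_cos_unit integral_sin_unit)+
  note sq = square_integrable_waves [folded x_def]
  have "cos_wave k \<bullet> cos_wave l = (\<integral>t. (cos (x (k - l) t) + cos (x (k + l) t)) / 2 \<partial>unit_leb)"
    unfolding cos_wave_def x_def [symmetric] inner_abs_l2 [OF sq(1) sq(1)] cos_times_cos x ..
  then show "cos_wave k \<bullet> cos_wave l = ((if k = l then 1 else 0) + (if k = - l then 1 else 0)) / 2"
    using int by (simp add: I eq_neg_iff_add_eq_0)
  have "sin_wave k \<bullet> sin_wave l = (\<integral>t. (cos (x (k - l) t) - cos (x (k + l) t)) / 2 \<partial>unit_leb)"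
    unfolding sin_wave_def x_def [symmetric] inner_abs_l2 [OF sq(2) sq(2)] sin_times_sin x ..
  then show "sin_wave k \<bullet> sin_wave l = ((if k = l then 1 else 0) - (if k = - l then 1 else 0)) / 2"
    using int by (simp add: I eq_neg_iff_add_eq_0)
  have "sin_wave k \<bullet> cos_wave l = (\<integral>t. (sin (x (k + l) t) + sin (x (k - l) t)) / 2 \<partial>unit_leb)"
    unfolding sin_wave_def cos_wave_def x_def [symmetric] inner_abs_l2 [OF sq(2) sq(1)] sin_times_cos x ..
  then show "sin_wave k \<bullet> cos_wave l = 0"
    using int by (simp add: I)
qed

lemma cos_mode_wave: "cos_mode j = sqrt 2 *\<^sub>R cos_wave (int j)"
  using abs_l2_scale [OF square_integrable_waves(1), of "sqrt 2" "int j"]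
  by (simp add: cos_mode_def cos_wave_def)

lemma sin_mode_wave: "sin_mode j = sqrt 2 *\<^sub>R sin_wave (int j)"
  using abs_l2_scale [OF square_integrable_waves(2), of "sqrt 2" "int j"]
  by (simp add: sin_mode_def sin_wave_def)

lemma one_l2_wave: "one_l2 = cos_wave 0"
  by (simp add: one_l2_def cos_wave_def)

text \<open>The numbering is chosen so that mode \<open>k \<ge> 1\<close> has frequency \<open>k div 2\<close>; index \<open>0\<close> is junk.\<close>

definition trig_mode :: "nat \<Rightarrow> l2" where
  "trig_mode k = (if k \<le> 1 then one_l2 else if even k then cos_mode (k div 2) else sin_mode (k div 2))"

lemma trig_mode_simps:
  "trig_mode 1 = one_l2"
  "trig_mode (Suc 0) = one_l2"
  "j \<ge> 1 \<Longrightarrow> trig_mode (2 * j) = cos_mode j"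
  "j \<ge> 1 \<Longrightarrow> trig_mode (2 * j + 1) = sin_mode j"
  "j \<ge> 1 \<Longrightarrow> trig_mode (Suc (2 * j)) = sin_mode j"
  by (auto simp: trig_mode_def)

lemma mode_index_cases:
  assumes "k \<ge> (1::nat)"
  obtains "k = 1" | j where "j \<ge> 1" "k = 2 * j" | j where "j \<ge> 1" "k = 2 * j + 1"
proof (cases "k = 1")
  case False
  have "k div 2 \<ge> 1" using assms False by linarith
  moreover have "k = 2 * (k div 2) \<or> k = 2 * (k div 2) + 1" by presburger
  ultimately show thesis using that by blast
qed (use that in blast)

lemma orthonormal_trig_mode: "orthonormal_on trig_mode {1..}"
proof -
  have "trig_mode i \<bullet> trig_mode j = (if i = j then 1 else 0)" if "i \<ge> 1" "j \<ge> 1" for i j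
    using that(1)
  proof (cases i rule: mode_index_cases)
    case 1
    from that(2) show ?thesis
      by (cases j rule: mode_index_cases)
         (auto simp: 1 trig_mode_simps cos_mode_wave sin_mode_wave one_l2_wave wave_inner inner_commute [of "cos_wave _" "sin_wave _"])
  next
    case (2 k)
    from that(2) show ?thesis
      by (cases j rule: mode_index_cases;
          use 2 in \<open>auto simp: trig_mode_simps cos_mode_wave sin_mode_wave one_l2_wave wave_inner inner_commute [of "cos_wave _" "sin_wave _"]\<close>; presburger)
  next
    case (3 k)
    from that(2) show ?thesis
      by (cases j rule: mode_index_cases;
          use 3 in \<open>auto simp: trig_mode_simps cos_mode_wave sin_mode_wave one_l2_wave wave_inner inner_commute [of "cos_wave _" "sin_wave _"]\<close>; presburger)
  qed
  then show ?thesis by (simp add: orthonormal_on_def)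
qed

lemma wave_uminus: "cos_wave (- k) = cos_wave k" "sin_wave (- k) = - sin_wave k"
  using abs_l2_scale [OF square_integrable_waves(2), of "-1" k]
  by (simp_all add: cos_wave_def sin_wave_def)

lemma wave_in_span: "cos_wave k \<in> span (trig_mode ` {1..})" "sin_wave k \<in> span (trig_mode ` {1..})"
proof -
  have *: "cos_wave (int j) \<in> span (trig_mode ` {1..}) \<and> sin_wave (int j) \<in> span (trig_mode ` {1..})" for j
  proof (cases "j = 0")
    case True
    have "trig_mode 1 \<in> span (trig_mode ` {1..})" by (intro span_base) auto
    moreover have "sin_wave 0 = 0"
      using wave_inner(2) [of 0 0] by simp
    ultimately show ?thesis using True by (simp add: trig_mode_simps one_l2_wave span_zero)
  next
    case False
    have "trig_mode (2 * j) \<in> span (trig_mode ` {1..})" "trig_mode (2 * j + 1) \<in> span (trig_mode ` {1..})"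
      using False by (auto intro!: span_base)
    then have "(1 / sqrt 2) *\<^sub>R cos_mode j \<in> span (trig_mode ` {1..})"
      "(1 / sqrt 2) *\<^sub>R sin_mode j \<in> span (trig_mode ` {1..})"
      using False by (auto simp: trig_mode_simps intro!: span_scale)
    then show ?thesis by (simp add: cos_mode_wave sin_mode_wave)
  qed
  show "cos_wave k \<in> span (trig_mode ` {1..})" "sin_wave k \<in> span (trig_mode ` {1..})"
    using * by (cases k rule: int_cases2; simp add: wave_uminus span_neg)+
qed

text \<open>Completeness of the Fourier system: every trigonometric polynomial is a finite
  combination of waves, and these are dense. Parseval thereby holds for every element of
  \<open>l2\<close>.\<close>

theorem closure_span_trig_mode: "closure (span (trig_mode ` {1..})) = UNIV"
proof (rule dense_l2_trig_poly)
  fix p assume "trig_poly p"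
  then have "abs_l2 p \<in> span (trig_mode ` {1..})"
  proof induction
    case (cos c k)
    then show ?case
      unfolding abs_l2_scale [OF square_integrable_waves(1)] cos_wave_def [symmetric]
      by (intro span_scale wave_in_span)
  next
    case (sin c k)
    then show ?case
      unfolding abs_l2_scale [OF square_integrable_waves(2)] sin_wave_def [symmetric]
      by (intro span_scale wave_in_span)
  next
    case (add p q)
    then have "square_integrable p" "square_integrable q"
      by (auto intro: square_integrable_continuous trig_poly_continuous)
    with add show ?case by (simp add: abs_l2_add span_add)
  qed
  then show "abs_l2 p \<in> closure (span (trig_mode ` {1..}))"
    using closure_subset by blast
qed simp

lemmas parseval_trig_mode =
  parseval_has_sum [OF orthonormal_trig_mode, unfolded closure_span_trig_mode, OF UNIV_I]

lemmas trig_mode_expansion =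
  eq_sum_of_coeffs_zero [OF orthonormal_trig_mode, unfolded closure_span_trig_mode, OF UNIV_I]

section \<open>Weak derivatives on the circle\<close>

lemma has_weak_deriv_periodic:
  assumes f: "\<And>t. (f has_real_derivative f' t) (at t)" "continuous_on UNIV f'" "f 1 = f 0"
  shows "has_weak_deriv (abs_l2 f) (abs_l2 f')"
  unfolding has_weak_deriv_def
proof (intro allI impI)
  fix p assume p: "circle_test p"
  \<comment> \<open>The orders 0 and 1 of the smoothness condition: \<open>p\<close> is
    differentiable, and so is its derivative, which is therefore continuous.\<close>
  have "(deriv ^^ 0) p differentiable at t" "(deriv ^^ Suc 0) p differentiable at t" for t
    using p unfolding circle_test_def by blast+
  then have d: "p differentiable at t" "deriv p differentiable at t" for t
    by simp_all
  have p': "(p has_real_derivative deriv p t) (at t)" for t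
    using d(1) by (simp add: DERIV_deriv_iff_real_differentiable)
  have c: "continuous_on UNIV f" "continuous_on UNIV p" "continuous_on UNIV (deriv p)"
    using f(1) p' d(2) by (auto simp: continuous_on_eq_continuous_at intro: DERIV_isCont differentiable_imp_continuous_within)
  have p1: "p 1 = p 0" using p [unfolded circle_test_def] by (metis add_0)
  have sq: "square_integrable f" "square_integrable f'" "square_integrable p" "square_integrable (deriv p)"
    using c f(2) by (auto intro: square_integrable_continuous)
  \<comment> \<open>The integrand is the derivative of the product of \<open>f\<close> and
    \<open>p\<close>, which has equal endpoint values; this is integration by parts.\<close>
  have "(\<integral>t. f t * deriv p t + f' t * p t \<partial>unit_leb) = 0"
  proof (rule integral_deriv_periodic [of "\<lambda>t. f t * p t"])
    show "((\<lambda>t. f t * p t) has_real_derivative f t * deriv p t + f' t * p t) (at t)" for t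
      using DERIV_mult [OF f(1) p'] by (simp add: algebra_simps)
    show "continuous_on UNIV (\<lambda>t. f t * deriv p t + f' t * p t)"
      by (intro continuous_intros c f)
    show "f 1 * p 1 = f 0 * p 0" using f(3) p1 by simp
  qed
  then show "abs_l2 f \<bullet> abs_l2 (deriv p) = - (abs_l2 f' \<bullet> abs_l2 p)"
    using sq by (simp add: inner_abs_l2 square_integrable_mult)
qed

lemma has_weak_deriv_add:
  "has_weak_deriv f f' \<Longrightarrow> has_weak_deriv g g' \<Longrightarrow> has_weak_deriv (f + g) (f' + g')"
  by (simp add: has_weak_deriv_def inner_add_left)

lemma has_weak_deriv_scale:
  "has_weak_deriv f f' \<Longrightarrow> has_weak_deriv (c *\<^sub>R f) (c *\<^sub>R f')"
  by (simp add: has_weak_deriv_def)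

lemma has_weak_deriv_zero: "has_weak_deriv 0 0"
  by (simp add: has_weak_deriv_def)

lemma has_weak_deriv_coeffs:
  assumes "has_weak_deriv f g"
  shows "g \<bullet> cos_wave k = 2 * pi * of_int k * (f \<bullet> sin_wave k)"
    and "g \<bullet> sin_wave k = - (2 * pi * of_int k * (f \<bullet> cos_wave k))"
  using fourier_coeff_weak_deriv [OF assms, of k]
  by (simp_all add: fourier_coeff_def cos_wave_def sin_wave_def complex_eq_iff)

text \<open>The difference of two weak derivatives is a weak derivative of 0. All its Fourier
  coefficients vanish, so it is 0 by completeness. This gives the definite description in
  \<open>D\<close> its meaning.\<close>

lemma has_weak_deriv_unique:
  assumes "has_weak_deriv f g" "has_weak_deriv f h"
  shows "g = h"
proof -
  have "has_weak_deriv 0 (g - h)"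
    using has_weak_deriv_add [OF assms(1) has_weak_deriv_scale [OF assms(2), of "-1"]] by simp
  from has_weak_deriv_coeffs [OF this]
  have "(g - h) \<bullet> trig_mode k = 0" for k
    by (simp add: trig_mode_def cos_mode_wave sin_mode_wave one_l2_wave)
  then have "g - h = 0"
    using trig_mode_expansion [of "{}" "g - h"] by simp
  then show ?thesis by simp
qed

lemma D_eqI: "has_weak_deriv f g \<Longrightarrow> D f = g"
  unfolding D_def using has_weak_deriv_unique by blast

lemma has_weak_deriv_D: "f \<in> sobolev \<Longrightarrow> has_weak_deriv f (D f)"
  unfolding sobolev_def using D_eqI by blast

lemma has_weak_deriv_sum:
  assumes "\<And>k. k \<in> K \<Longrightarrow> f k \<in> sobolev"
  shows "has_weak_deriv (\<Sum>k\<in>K. c k *\<^sub>R f k) (\<Sum>k\<in>K. c k *\<^sub>R D (f k))"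
  using assms
  by (induction K rule: infinite_finite_induct)
     (auto intro: has_weak_deriv_zero has_weak_deriv_add has_weak_deriv_scale has_weak_deriv_D)

lemma sobolev_sum: "(\<And>k. k \<in> K \<Longrightarrow> f k \<in> sobolev) \<Longrightarrow> (\<Sum>k\<in>K. c k *\<^sub>R f k) \<in> sobolev"
  using has_weak_deriv_sum [of K f c] by (auto simp: sobolev_def)

lemma D_sum: "(\<And>k. k \<in> K \<Longrightarrow> f k \<in> sobolev) \<Longrightarrow> D (\<Sum>k\<in>K. c k *\<^sub>R f k) = (\<Sum>k\<in>K. c k *\<^sub>R D (f k))"
  using has_weak_deriv_sum [of K f c] by (auto intro: D_eqI)

lemma trig_mode_sobolev: "trig_mode k \<in> sobolev"
proof -
  have C: "has_weak_deriv (cos_wave i) (abs_l2 (\<lambda>t. - (2 * pi * of_int i) * sin (2 * pi * of_int i * t)))" for i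
    unfolding cos_wave_def
  proof (rule has_weak_deriv_periodic)
    show "((\<lambda>t. cos (2 * pi * real_of_int i * t)) has_real_derivative - (2 * pi * of_int i) * sin (2 * pi * of_int i * t)) (at t)" for t
      by (auto intro!: derivative_eq_intros)
  qed (auto intro!: continuous_intros)
  have S: "has_weak_deriv (sin_wave i) (abs_l2 (\<lambda>t. (2 * pi * of_int i) * cos (2 * pi * of_int i * t)))" for i
    unfolding sin_wave_def
  proof (rule has_weak_deriv_periodic)
    show "((\<lambda>t. sin (2 * pi * real_of_int i * t)) has_real_derivative (2 * pi * of_int i) * cos (2 * pi * of_int i * t)) (at t)" for t
      by (auto intro!: derivative_eq_intros)
  qed (auto intro!: continuous_intros)
  show ?thesis
    using has_weak_deriv_scale [OF C, of "sqrt 2"] has_weak_deriv_scale [OF S, of "sqrt 2"] C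
    by (auto simp: trig_mode_def cos_mode_wave sin_mode_wave one_l2_wave sobolev_def)
qed

section \<open>Energies: the eigenvalues of minus the second derivative on the Fourier modes\<close>

definition mode_energy :: "nat \<Rightarrow> real" where
  "mode_energy k = 4 * pi\<^sup>2 * (real (k div 2))\<^sup>2"

lemma mode_energy_mono: "i \<le> k \<Longrightarrow> mode_energy i \<le> mode_energy k"
  unfolding mode_energy_def by (intro mult_left_mono power_mono) (auto simp: div_le_mono)

lemma mode_energy_less_iff: "mode_energy i < mode_energy k \<longleftrightarrow> i div 2 < k div 2"
proof -
  have "mode_energy i < mode_energy k \<longleftrightarrow> (real (i div 2))\<^sup>2 < (real (k div 2))\<^sup>2"
    unfolding mode_energy_def by (simp add: mult_less_cancel_left_pos)
  also have "\<dots> \<longleftrightarrow> i div 2 < k div 2"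
    by (metis of_nat_0_le_iff of_nat_less_iff power_less_imp_less_base power_strict_mono zero_less_numeral)
  finally show ?thesis .
qed

text \<open>Differentiation exchanges the cosine and the sine of the same frequency.\<close>

lemma D_coeffs:
  assumes f: "f \<in> sobolev" and "k \<ge> 1"
  defines "k' \<equiv> if k = 1 then 1 else if even k then k + 1 else k - 1"
  shows "(D f \<bullet> trig_mode k)\<^sup>2 = mode_energy k' * (f \<bullet> trig_mode k')\<^sup>2"
  using \<open>k \<ge> 1\<close>
proof (cases k rule: mode_index_cases)
  case 1
  then show ?thesis
    using has_weak_deriv_coeffs(1) [OF has_weak_deriv_D [OF f], of 0]
    by (simp add: k'_def trig_mode_simps one_l2_wave mode_energy_def)
next
  case (2 j)
  then show ?thesis
    using has_weak_deriv_coeffs(1) [OF has_weak_deriv_D [OF f], of "int j"]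
    by (simp add: k'_def trig_mode_simps cos_mode_wave sin_mode_wave mode_energy_def power_mult_distrib)
next
  case (3 j)
  then show ?thesis
    using has_weak_deriv_coeffs(2) [OF has_weak_deriv_D [OF f], of "int j"]
    by (simp add: k'_def trig_mode_simps cos_mode_wave sin_mode_wave mode_energy_def power_mult_distrib)
qed

text \<open>Parseval for \<open>D f\<close>, reindexed. The involution \<open>s\<close> swaps
  \<open>2 * j\<close> with \<open>2 * j + 1\<close> and fixes 1, which undoes the exchange of
  cosine and sine by \<open>D\<close>.\<close>

lemma norm_D_has_sum:
  assumes f: "f \<in> sobolev"
  shows "((\<lambda>k. mode_energy k * (f \<bullet> trig_mode k)\<^sup>2) has_sum (norm (D f))\<^sup>2) {1..}"
proof -
  define s where "s k = (if k = 1 then 1 else if even k then k + 1 else k - 1)" for k :: nat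
  have ss: "s (s k) = k" "s k \<ge> 1" if "k \<ge> 1" for k
    using that by (auto simp: s_def elim!: oddE)
  have "bij_betw s {1..} {1..}"
    by (rule bij_betw_byWitness [of _ s]) (use ss in auto)
  moreover have "((\<lambda>k. mode_energy (s k) * (f \<bullet> trig_mode (s k))\<^sup>2) has_sum (norm (D f))\<^sup>2) {1..}"
    using parseval_trig_mode [of "D f"]
    by (rule has_sum_cong [THEN iffD1, rotated]) (use D_coeffs [OF f] in \<open>simp add: s_def\<close>)
  ultimately show ?thesis
    using has_sum_reindex_bij_betw [of s "{1..}" "{1..}" "\<lambda>k. mode_energy k * (f \<bullet> trig_mode k)\<^sup>2"] by blast
qed

text \<open>The energy series minus \<open>\<mu>\<close> times Parseval. For
  \<open>\<mu> = mode_energy m\<close> the signs are known: non-positive up to \<open>m\<close>,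
  non-negative from \<open>m\<close> on.\<close>

lemma energy_excess_has_sum:
  assumes f: "f \<in> sobolev"
  shows "((\<lambda>k. (mode_energy k - \<mu>) * (f \<bullet> trig_mode k)\<^sup>2) has_sum ((norm (D f))\<^sup>2 - \<mu> * (norm f)\<^sup>2)) {1..}"
  using has_sum_add [OF norm_D_has_sum [OF f] has_sum_cmult_right [OF parseval_trig_mode, of "- \<mu>" f]]
  by (simp add: left_diff_distrib)

text \<open>The terms beyond \<open>m\<close> are non-negative and are dropped.\<close>

lemma energy_excess_ge:
  assumes f: "f \<in> sobolev"
  shows "(\<Sum>k=1..m. (mode_energy k - mode_energy m) * (f \<bullet> trig_mode k)\<^sup>2)
    \<le> (norm (D f))\<^sup>2 - mode_energy m * (norm f)\<^sup>2"
  by (rule finite_sum_le_has_sum [OF energy_excess_has_sum [OF f]])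
     (auto intro!: mult_nonneg_nonneg simp: mode_energy_mono)

text \<open>The equality case of the Poincare inequality on the orthogonal complement of the low modes.\<close>

lemma energy_minimal_imp_pure_frequency:
  assumes f: "f \<in> sobolev" and j: "j \<ge> 1"
    and orth: "\<And>k. k \<ge> 1 \<Longrightarrow> k div 2 < j \<Longrightarrow> f \<bullet> trig_mode k = 0"
    and le: "(norm (D f))\<^sup>2 \<le> mode_energy (2 * j) * (norm f)\<^sup>2"
  shows "f \<in> span {cos_mode j, sin_mode j}"
proof -
  have zero: "f \<bullet> trig_mode k = 0" if k: "k \<in> {1..} - {2 * j, 2 * j + 1}" for k
  proof (cases "k div 2 < j")
    case True
    then show ?thesis using orth k by auto
  next
    case False
    have gt: "mode_energy (2 * j) < mode_energy k"
      unfolding mode_energy_less_iff using False k by auto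
    \<comment> \<open>The low terms vanish by \<open>orth\<close> and the others have non-negative
      weights. A series of non-negative terms with total at most 0 vanishes term by term.\<close>
    have "(mode_energy k - mode_energy (2 * j)) * (f \<bullet> trig_mode k)\<^sup>2 = 0"
    proof (rule nonneg_has_sum_le_0D [OF energy_excess_has_sum [OF f, of "mode_energy (2 * j)"]])
      fix i :: nat assume i: "i \<in> {1..}"
      show "0 \<le> (mode_energy i - mode_energy (2 * j)) * (f \<bullet> trig_mode i)\<^sup>2"
        using orth [of i] i mode_energy_less_iff [of i "2 * j"] by (cases "i div 2 < j") auto
    qed (use le k in auto)
    with gt show ?thesis by simp
  qed
  have "f = (\<Sum>k\<in>{2 * j, 2 * j + 1}. (f \<bullet> trig_mode k) *\<^sub>R trig_mode k)"
    by (rule trig_mode_expansion) (use j zero in auto)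
  then have "f = (f \<bullet> cos_mode j) *\<^sub>R cos_mode j + (f \<bullet> sin_mode j) *\<^sub>R sin_mode j"
    using j by (simp add: trig_mode_simps)
  then show ?thesis
    by (metis insertI1 insertI2 singletonI span_add span_base span_scale)
qed

section \<open>Singular values and the energy inequality\<close>

text \<open>With the eigenvectors as columns of the constant matrix \<open>P\<close>, the
  characteristic matrix satisfies \<open>Q ** P = P ** L\<close> with \<open>L\<close> diagonal.
  Orthonormality makes \<open>det P\<close> square to 1, so it cancels in the polynomial
  ring.\<close>

lemma charpoly_orthonormal_eigenbasis:
  fixes A :: "real ^ 'd ^ 'd"
  assumes u: "orthonormal_on u {1..CARD('d)}"
    and ev: "\<And>k. k \<in> {1..CARD('d)} \<Longrightarrow> A *v u k = l k *\<^sub>R u k"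
  shows "charpoly A = (\<Prod>k=1..CARD('d). [:- l k, 1:])"
proof -
  \<comment> \<open>The basis is numbered by naturals while matrices are indexed by the type
    \<open>'d\<close>; \<open>g\<close> translates between the two.\<close>
  obtain g :: "'d \<Rightarrow> nat" where g: "bij_betw g UNIV {1..CARD('d)}"
    using finite_same_card_bij [of "UNIV :: 'd set" "{1..CARD('d)}"] by auto
  have gI: "g i \<in> {1..CARD('d)}" for i using g by (auto dest: bij_betwE)
  have ginj: "g i = g j \<longleftrightarrow> i = j" for i j using g by (auto simp: bij_betw_def inj_on_def)
  define P :: "real poly ^ 'd ^ 'd" where "P = (\<chi> i j. [:u (g j) $ i:])"
  define L :: "real poly ^ 'd ^ 'd" where "L = (\<chi> i j. if i = j then [:- l (g i), 1:] else 0)"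
  define Q :: "real poly ^ 'd ^ 'd" where "Q = mat [:0, 1:] - (\<chi> i j. [:A $ i $ j:])"
  have const_sum: "(\<Sum>k\<in>K. [:h k:]) = [:\<Sum>k\<in>K. h k:]" for h :: "'d \<Rightarrow> real" and K
    by (induction K rule: infinite_finite_induct) auto
  have "(Q ** P) $ i $ j = (P ** L) $ i $ j" for i j
  proof -
    have "(Q ** P) $ i $ j = (\<Sum>k\<in>UNIV. (if i = k then [:0, 1:] * [:u (g j) $ k:] else 0) - [:A $ i $ k * u (g j) $ k:])"
      unfolding matrix_matrix_mult_def Q_def P_def by (auto simp: mat_def algebra_simps intro!: sum.cong)
    also have "\<dots> = [:0, u (g j) $ i:] - [:\<Sum>k\<in>UNIV. A $ i $ k * u (g j) $ k:]"
      by (simp add: sum_subtractf const_sum)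
    also have "(\<Sum>k\<in>UNIV. A $ i $ k * u (g j) $ k) = l (g j) * u (g j) $ i"
      using ev [OF gI, of j] by (simp add: vec_eq_iff matrix_vector_mult_def)
    also have "[:0, u (g j) $ i:] - [:l (g j) * u (g j) $ i:] = (P ** L) $ i $ j"
    proof -
      have "(P ** L) $ i $ j = (\<Sum>k\<in>UNIV. if k = j then [:u (g k) $ i:] * [:- l (g k), 1:] else 0)"
        unfolding matrix_matrix_mult_def L_def P_def vec_lambda_beta by (intro sum.cong refl) simp
      then show ?thesis unfolding sum.delta [OF finite] by simp
    qed
    finally show ?thesis .
  qed
  then have "Q ** P = P ** L" by (simp add: vec_eq_iff)
  then have "det Q * det P = det P * det L" by (metis det_mul)
  moreover have "det P \<noteq> 0"
  proof -
    have "transpose P ** P = mat 1"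
    proof -
      have "(transpose P ** P) $ i $ j = [:u (g i) \<bullet> u (g j):]" for i j
        by (simp add: matrix_matrix_mult_def transpose_def P_def const_sum inner_vec_def mult.commute)
      then show ?thesis
        using orthonormal_onD [OF u gI gI] by (simp add: vec_eq_iff mat_def ginj one_pCons)
    qed
    then have "det P * det P = 1" by (metis det_I det_mul det_transpose)
    then show ?thesis by auto
  qed
  moreover have "det L = (\<Prod>k=1..CARD('d). [:- l k, 1:])"
  proof -
    have "det L = (\<Prod>i\<in>UNIV. L $ i $ i)"
      by (rule det_diagonal) (simp add: L_def)
    also have "\<dots> = (\<Prod>i\<in>UNIV. [:- l (g i), 1:])"
      by (simp add: L_def)
    also have "\<dots> = (\<Prod>k=1..CARD('d). [:- l k, 1:])"
      by (rule prod.reindex_bij_betw [OF g])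
    finally show ?thesis .
  qed
  ultimately show ?thesis by (simp add: charpoly_def Q_def mult.commute)
qed

lemma left_singular_basisD:
  fixes X :: "real ^ 'n ^ 'd"
  assumes "left_singular_basis X u"
  shows "orthonormal_on u {1..CARD('d)}" "span (u ` {1..CARD('d)}) = UNIV"
    and "k \<in> {1..CARD('d)} \<Longrightarrow> (X ** transpose X) *v u k = (singular_value X k)\<^sup>2 *\<^sub>R u k"
  using assms by (auto simp: left_singular_basis_def orthonormal_basis_of_iff)

text \<open>\<open>singular_value\<close> reads a list by position, so the list must be known to
  have \<open>CARD('d)\<close> elements. The eigenbasis splits the characteristic polynomial and
  gives this length; the elements are square roots of squares, hence non-negative.\<close>

lemma singular_value_sorted:
  fixes X :: "real ^ 'n ^ 'd"
  assumes "left_singular_basis X u"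
  shows "k \<in> {1..CARD('d)} \<Longrightarrow> 0 \<le> singular_value X k"
    and "1 \<le> i \<Longrightarrow> i \<le> k \<Longrightarrow> k \<le> CARD('d) \<Longrightarrow> singular_value X k \<le> singular_value X i"
proof -
  note u = left_singular_basisD [OF assms]
  define M where "M = image_mset sqrt (proots (charpoly (X ** transpose X)))"
  define xs where "xs = rev (sorted_list_of_multiset M)"
  have "charpoly (X ** transpose X) = (\<Prod>k=1..CARD('d). [:- (singular_value X k)\<^sup>2, 1:])"
    by (rule charpoly_orthonormal_eigenbasis [OF u(1)]) (rule u(3))
  then have "proots (charpoly (X ** transpose X)) = (\<Sum>k=1..CARD('d). {#(singular_value X k)\<^sup>2#})"
    by (simp add: proots_prod)
  then have M: "M = image_mset (\<lambda>k. \<bar>singular_value X k\<bar>) (mset_set {1..CARD('d)})"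
    by (simp add: M_def sum_unfold_sum_mset image_mset.compositionality o_def)
  have sv: "singular_value X k = xs ! (k - 1)" for k
    by (simp add: singular_value_def xs_def M_def)
  have len: "length xs = CARD('d)"
    by (simp add: xs_def M flip: size_mset)
  have nonneg: "0 \<le> x" if "x \<in> set xs" for x
    using that by (auto simp: xs_def M)
  show "0 \<le> singular_value X k" if "k \<in> {1..CARD('d)}"
    unfolding sv using that len by (intro nonneg nth_mem) auto
  have "sorted (rev xs)" by (simp add: xs_def)
  then show "singular_value X k \<le> singular_value X i" if "1 \<le> i" "i \<le> k" "k \<le> CARD('d)"
    unfolding sv using that len by (intro sorted_rev_nth_mono) auto
qed

section \<open>The objective in the coordinates of the singular basis\<close>

lemma sobolev_isometriesD:
  assumes "\<Phi> \<in> sobolev_isometries"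
  shows "linear \<Phi>" "norm (\<Phi> x) = norm x" "\<Phi> x \<in> sobolev" "\<Phi> x \<bullet> \<Phi> y = x \<bullet> y"
proof -
  show *: "linear \<Phi>" "norm (\<Phi> x) = norm x" "\<Phi> x \<in> sobolev" for x
    using assms by (auto simp: sobolev_isometries_def)
  show "\<Phi> x \<bullet> \<Phi> y = x \<bullet> y"
    \<comment> \<open>Polarisation recovers the inner product from the norms.\<close>
    by (simp add: dot_norm *(2) flip: linear_add [OF *(1)])
qed

lemma isometry_expansion:
  fixes X :: "real ^ 'n ^ 'd"
  assumes "left_singular_basis X u" "linear \<Phi>"
  shows "\<Phi> x = (\<Sum>k=1..CARD('d). (x \<bullet> u k) *\<^sub>R \<Phi> (u k))"
proof -
  have "x = (\<Sum>k=1..CARD('d). (x \<bullet> u k) *\<^sub>R u k)"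
    by (rule expansion_orthonormal) (use left_singular_basisD [OF assms(1)] in auto)
  then have "\<Phi> x = \<Phi> (\<Sum>k=1..CARD('d). (x \<bullet> u k) *\<^sub>R u k)"
    by (rule arg_cong)
  then show ?thesis using assms(2) by (simp add: linear_sum linear_scale)
qed

text \<open>\<open>X ** transpose X\<close> is the sum of the rank-one matrices built from the
  columns.\<close>

lemma sum_column_inner:
  fixes X :: "real ^ 'n ^ 'd"
  shows "(\<Sum>i\<in>UNIV. (column i X \<bullet> v) * (column i X \<bullet> w)) = ((X ** transpose X) *v v) \<bullet> w"
proof -
  have "(transpose X *v v) $ i = column i X \<bullet> v" for i
    by (simp add: matrix_vector_mult_def transpose_def column_def inner_vec_def)
  then have "(X ** transpose X) *v v = (\<Sum>i\<in>UNIV. (column i X \<bullet> v) *\<^sub>R column i X)"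
    unfolding matrix_vector_mul_assoc [symmetric] matrix_mult_sum [of X] by (simp add: scalar_mult_eq_scaleR)
  then show ?thesis by (simp add: inner_sum_left)
qed

text \<open>Expanding each \<open>D (\<Phi> x)\<close> over the singular basis leaves cross terms
  \<open>g k \<bullet> g l\<close>. Their coefficients are the entries of
  \<open>X ** transpose X\<close> in that basis and vanish off the diagonal. The cancellation comes
  from the data: the derivatives \<open>g k\<close> may fail to be orthogonal.\<close>

lemma mean_quadratic_variation_eq:
  fixes X :: "real ^ 'n ^ 'd"
  assumes lsb: "left_singular_basis X u" and Phi: "\<Phi> \<in> sobolev_isometries"
  shows "mean_quadratic_variation X \<Phi> =
    1 / real CARD('n) * (\<Sum>k=1..CARD('d). (singular_value X k)\<^sup>2 * (norm (D (\<Phi> (u k))))\<^sup>2)"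
proof -
  note u = left_singular_basisD [OF lsb] and P = sobolev_isometriesD [OF Phi]
  let ?K = "{1..CARD('d)}"
  define g where "g k = D (\<Phi> (u k))" for k
  have D: "D (\<Phi> x) = (\<Sum>k\<in>?K. (x \<bullet> u k) *\<^sub>R g k)" for x
    unfolding isometry_expansion [OF lsb P(1), of x] g_def by (rule D_sum) (rule P(3))
  have "(\<Sum>i\<in>UNIV. (norm (D (\<Phi> (column i X))))\<^sup>2) =
      (\<Sum>i\<in>UNIV. \<Sum>k\<in>?K. \<Sum>l\<in>?K. ((column i X \<bullet> u k) * (column i X \<bullet> u l)) * (g k \<bullet> g l))"
    unfolding D power2_norm_eq_inner inner_sum_left inner_sum_right
    by (intro sum.cong refl) (simp add: inner_commute mult_ac)
  also have "\<dots> = (\<Sum>k\<in>?K. \<Sum>i\<in>UNIV. \<Sum>l\<in>?K. ((column i X \<bullet> u k) * (column i X \<bullet> u l)) * (g k \<bullet> g l))"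
    by (rule sum.swap)
  also have "\<dots> = (\<Sum>k\<in>?K. \<Sum>l\<in>?K. (\<Sum>i\<in>UNIV. (column i X \<bullet> u k) * (column i X \<bullet> u l)) * (g k \<bullet> g l))"
    unfolding sum_distrib_right by (intro sum.cong refl sum.swap)
  also have "\<dots> = (\<Sum>k\<in>?K. \<Sum>l\<in>?K. if l = k then (singular_value X k)\<^sup>2 * (g k \<bullet> g k) else 0)"
    unfolding sum_column_inner
    by (intro sum.cong refl) (use u(3) orthonormal_onD [OF u(1)] in auto)
  also have "\<dots> = (\<Sum>k\<in>?K. (singular_value X k)\<^sup>2 * (norm (g k))\<^sup>2)"
    by (intro sum.cong refl) (simp add: power2_norm_eq_inner)
  finally show ?thesis by (simp add: mean_quadratic_variation_def g_def)
qed

text \<open>Including the index 1 changes nothing because \<open>1 div 2 = 0\<close>; it lets the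
  bound be compared with the objective term by term.\<close>

lemma mqv_bound_eq:
  "mqv_bound (X :: real ^ 'n ^ 'd) =
    1 / real CARD('n) * (\<Sum>k=1..CARD('d). (singular_value X k)\<^sup>2 * mode_energy k)"
proof -
  have "(\<Sum>k=1..CARD('d). (singular_value X k)\<^sup>2 * mode_energy k) =
      (\<Sum>k=2..CARD('d). (singular_value X k)\<^sup>2 * mode_energy k)"
    by (rule sum.mono_neutral_right) (auto simp: mode_energy_def)
  then show ?thesis by (simp add: mqv_bound_def mode_energy_def mult_ac)
qed

text \<open>Ky Fan's trace minimum principle for the energies of the Fourier modes.\<close>

lemma sum_mode_energy_le:
  assumes f: "orthonormal_on f {1..m}" "\<And>k. k \<in> {1..m} \<Longrightarrow> f k \<in> sobolev"
  shows "(\<Sum>k=1..m. mode_energy k) \<le> (\<Sum>k=1..m. (norm (D (f k)))\<^sup>2)"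
proof -
  let ?E = "\<lambda>i. mode_energy i - mode_energy m"
  have norm1: "(norm (f k))\<^sup>2 = 1" if "k \<in> {1..m}" for k
    using orthonormal_onD [OF f(1) that that] by (simp add: power2_norm_eq_inner)
  \<comment> \<open>The weights \<open>?E i\<close> are non-positive for \<open>i \<le> m\<close>,
    so multiplying them by the captured mass, at most 1 by Bessel, can only increase the
    sum.\<close>
  have "(\<Sum>i=1..m. ?E i) \<le> (\<Sum>i=1..m. ?E i * (\<Sum>k=1..m. (trig_mode i \<bullet> f k)\<^sup>2))"
  proof (rule sum_mono)
    fix i assume i: "i \<in> {1..m}"
    have "(\<Sum>k=1..m. (trig_mode i \<bullet> f k)\<^sup>2) \<le> (norm (trig_mode i))\<^sup>2"
      by (rule bessel_inequality [OF f(1)]) simp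
    also have "\<dots> = 1"
      using i orthonormal_onD [OF orthonormal_trig_mode, of i i] by (simp add: power2_norm_eq_inner)
    finally show "?E i \<le> ?E i * (\<Sum>k=1..m. (trig_mode i \<bullet> f k)\<^sup>2)"
      using i mode_energy_mono [of i m] mult_left_mono_neg [of _ 1 "?E i"] by fastforce
  qed
  also have "\<dots> = (\<Sum>k=1..m. \<Sum>i=1..m. ?E i * (f k \<bullet> trig_mode i)\<^sup>2)"
    unfolding sum_distrib_left by (subst sum.swap) (simp add: inner_commute)
  also have "\<dots> \<le> (\<Sum>k=1..m. (norm (D (f k)))\<^sup>2 - mode_energy m)"
  proof (rule sum_mono)
    fix k assume k: "k \<in> {1..m}"
    show "(\<Sum>i=1..m. ?E i * (f k \<bullet> trig_mode i)\<^sup>2) \<le> (norm (D (f k)))\<^sup>2 - mode_energy m"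
      using energy_excess_ge [OF f(2) [OF k], of m] norm1 [OF k] by simp
  qed
  finally show ?thesis by (simp add: sum_subtractf)
qed

section \<open>Summation by parts against decreasing weights\<close>

lemma abel_summation:
  fixes w x :: "nat \<Rightarrow> real"
  shows "(\<Sum>k=1..Suc d. w k * x k) =
    w (Suc d) * (\<Sum>k=1..Suc d. x k) + (\<Sum>m=1..d. (w m - w (Suc m)) * (\<Sum>k=1..m. x k))"
  by (induction d) (simp_all add: algebra_simps)

text \<open>Individual \<open>x k\<close> may be negative; only the prefix sums are controlled.
  Summation by parts rewrites the total through these prefix sums, the last weight and the
  non-negative drops of \<open>w\<close>.\<close>

lemma weighted_sum_nonneg:
  fixes w x :: "nat \<Rightarrow> real"
  assumes w: "\<And>k. 1 \<le> k \<Longrightarrow> k \<le> d \<Longrightarrow> 0 \<le> w k" "\<And>k. 1 \<le> k \<Longrightarrow> k < d \<Longrightarrow> w (Suc k) \<le> w k"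
    and x: "\<And>m. m \<le> d \<Longrightarrow> 0 \<le> (\<Sum>k=1..m. x k)"
  shows "0 \<le> (\<Sum>k=1..d. w k * x k)"
proof (cases d)
  case (Suc d')
  have "0 \<le> w (Suc d') * (\<Sum>k=1..Suc d'. x k)"
    using w(1) [of d] x [of d] Suc by (intro mult_nonneg_nonneg) auto
  moreover have "0 \<le> (w m - w (Suc m)) * (\<Sum>k=1..m. x k)" if "m \<in> {1..d'}" for m
    using w(2) [of m] x [of m] that Suc by (intro mult_nonneg_nonneg) auto
  ultimately show ?thesis
    unfolding Suc abel_summation by (intro add_nonneg_nonneg sum_nonneg)
qed simp

text \<open>The strictly positive drops and the positive last weight force every prefix sum to
  vanish, and each \<open>x k\<close> is a difference of two consecutive prefix sums.\<close>

lemma weighted_sum_zero: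
  fixes w x :: "nat \<Rightarrow> real"
  assumes w: "\<And>k. 1 \<le> k \<Longrightarrow> k \<le> d \<Longrightarrow> 0 < w k" "\<And>k. 1 \<le> k \<Longrightarrow> k < d \<Longrightarrow> w (Suc k) < w k"
    and x: "\<And>m. m \<le> d \<Longrightarrow> 0 \<le> (\<Sum>k=1..m. x k)"
    and zero: "(\<Sum>k=1..d. w k * x k) = 0" and k: "k \<in> {1..d}"
  shows "x k = 0"
proof -
  obtain d' where d: "d = Suc d'" using k by (cases d) auto
  let ?S = "\<lambda>m. \<Sum>k=1..m. x k"
  have 1: "0 \<le> w d * ?S d"
    using w(1) [of d] x [of d] d by (intro mult_nonneg_nonneg) auto
  have 2: "0 \<le> (w m - w (Suc m)) * ?S m" if "m \<in> {1..d'}" for m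
    using w(2) [of m] x [of m] that d by (intro mult_nonneg_nonneg) auto
  have sum0: "w d * ?S d + (\<Sum>m=1..d'. (w m - w (Suc m)) * ?S m) = 0"
    using zero unfolding d abel_summation .
  have "w d * ?S d = 0 \<and> (\<Sum>m=1..d'. (w m - w (Suc m)) * ?S m) = 0"
    using sum0 1 sum_nonneg [of "{1..d'}" "\<lambda>m. (w m - w (Suc m)) * ?S m", OF 2] by linarith
  then have Sd: "?S d = 0" and "\<forall>m\<in>{1..d'}. (w m - w (Suc m)) * ?S m = 0"
    using w(1) [of d] d sum_nonneg_eq_0_iff [of "{1..d'}" "\<lambda>m. (w m - w (Suc m)) * ?S m"] 2 by auto
  then have Sm: "?S m = 0" if "m \<in> {1..d'}" for m
    using that w(2) [of m] d by fastforce
  have S: "?S m = 0" if "m \<le> d" for m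
    using Sd Sm [of m] that d by (cases "m = 0 \<or> m = d") auto
  obtain k' where k': "k = Suc k'" using k by (cases k) auto
  show ?thesis using S [of k] S [of k'] k k' by simp
qed

section \<open>Functions of a single frequency\<close>

lemma pure_frequency_expansion:
  assumes j: "j \<ge> 1" and f: "f \<in> span {cos_mode j, sin_mode j}"
  shows "f = (f \<bullet> cos_mode j) *\<^sub>R cos_mode j + (f \<bullet> sin_mode j) *\<^sub>R sin_mode j"
proof -
  have "f = (\<Sum>k\<in>{2 * j, 2 * j + 1}. (f \<bullet> trig_mode k) *\<^sub>R trig_mode k)"
    by (rule expansion_orthonormal)
       (use j f orthonormal_on_subset [OF orthonormal_trig_mode, of "{2 * j, 2 * j + 1}"]
        in \<open>auto simp: trig_mode_simps\<close>)
  then show ?thesis using j by (simp add: trig_mode_simps)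
qed

lemma mode_inner:
  assumes "j \<ge> 1"
  shows "cos_mode j \<bullet> cos_mode j = 1" "sin_mode j \<bullet> sin_mode j = 1" "cos_mode j \<bullet> sin_mode j = 0"
    and "k \<ge> 1 \<Longrightarrow> k div 2 \<noteq> j \<Longrightarrow> cos_mode j \<bullet> trig_mode k = 0"
    and "k \<ge> 1 \<Longrightarrow> k div 2 \<noteq> j \<Longrightarrow> sin_mode j \<bullet> trig_mode k = 0"
  using assms orthonormal_onD [OF orthonormal_trig_mode, of "2 * j" "2 * j"]
    orthonormal_onD [OF orthonormal_trig_mode, of "2 * j + 1" "2 * j + 1"]
    orthonormal_onD [OF orthonormal_trig_mode, of "2 * j" "2 * j + 1"]
    orthonormal_onD [OF orthonormal_trig_mode, of "2 * j" k]
    orthonormal_onD [OF orthonormal_trig_mode, of "2 * j + 1" k]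
  by (auto simp: trig_mode_simps)

lemma pure_frequency_orthogonal:
  assumes "j \<ge> 1" "f \<in> span {cos_mode j, sin_mode j}" "k \<ge> 1" "k div 2 \<noteq> j"
  shows "f \<bullet> trig_mode k = 0"
  by (subst pure_frequency_expansion [OF assms(1,2)]) (simp add: inner_add_left mode_inner(4,5) [OF assms(1,3,4)])

lemma pure_frequencies_orthogonal:
  assumes j: "j \<ge> 1" "f \<in> span {cos_mode j, sin_mode j}"
    and l: "l \<ge> 1" "g \<in> span {cos_mode l, sin_mode l}" and "j \<noteq> l"
  shows "f \<bullet> g = 0"
  using pure_frequency_orthogonal [OF j, of "2 * l"] pure_frequency_orthogonal [OF j, of "2 * l + 1"] assms
  by (subst pure_frequency_expansion [OF l]) (simp add: inner_add_right trig_mode_simps)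

text \<open>With the shift \<open>\<mu> = mode_energy (2 * j)\<close> every term of the excess
  series is zero: either the frequency is \<open>j\<close> and the weight vanishes, or the
  coefficient does.\<close>

lemma pure_frequency_energy:
  assumes j: "j \<ge> 1" and f: "f \<in> span {cos_mode j, sin_mode j}"
  shows "f \<in> sobolev" "(norm (D f))\<^sup>2 = mode_energy (2 * j) * (norm f)\<^sup>2"
proof -
  have "f = (\<Sum>k\<in>{2 * j, 2 * j + 1}. (f \<bullet> trig_mode k) *\<^sub>R trig_mode k)"
    using pure_frequency_expansion [OF assms] j by (simp add: trig_mode_simps)
  then show S: "f \<in> sobolev"
    using sobolev_sum [of "{2 * j, 2 * j + 1}" trig_mode] trig_mode_sobolev by metis
  have "(mode_energy k - mode_energy (2 * j)) * (f \<bullet> trig_mode k)\<^sup>2 = 0" if "k \<in> {1..}" for k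
    using pure_frequency_orthogonal [OF assms, of k] that
    by (cases "k div 2 = j") (auto simp: mode_energy_def)
  then have "((\<lambda>k. (mode_energy k - mode_energy (2 * j)) * (f \<bullet> trig_mode k)\<^sup>2) has_sum 0) {1..}"
    by (intro has_sum_0)
  then have "(norm (D f))\<^sup>2 - mode_energy (2 * j) * (norm f)\<^sup>2 = 0"
    using energy_excess_has_sum [OF S] has_sum_unique by blast
  then show "(norm (D f))\<^sup>2 = mode_energy (2 * j) * (norm f)\<^sup>2" by simp
qed

text \<open>The two coordinate vectors have squared projections onto the pair summing to \<open>2\<close>, and by
  Bessel's inequality neither exceeds \<open>1\<close>; so both lie in the span of the pair.\<close>

lemma pure_frequency_basisI:
  assumes j: "j \<ge> 1" and on: "orthonormal_on \<phi> {2 * j, 2 * j + 1}"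
    and sp: "\<phi> (2 * j) \<in> span {cos_mode j, sin_mode j}" "\<phi> (2 * j + 1) \<in> span {cos_mode j, sin_mode j}"
  shows "orthonormal_basis_of \<phi> {2 * j, 2 * j + 1} (span {cos_mode j, sin_mode j})"
proof -
  let ?F = "{2 * j, 2 * j + 1}" and ?c = "cos_mode j" and ?s = "sin_mode j"
  have norm1: "(\<phi> k \<bullet> ?c)\<^sup>2 + (\<phi> k \<bullet> ?s)\<^sup>2 = 1" if "k \<in> ?F" for k
  proof -
    have k: "\<phi> k \<in> span {?c, ?s}" using sp that by auto
    have "\<phi> k \<bullet> \<phi> k = \<phi> k \<bullet> ((\<phi> k \<bullet> ?c) *\<^sub>R ?c + (\<phi> k \<bullet> ?s) *\<^sub>R ?s)"
      using pure_frequency_expansion [OF j k] by (rule arg_cong)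
    then show ?thesis
      using orthonormal_onD [OF on that that] by (simp add: inner_add_right power2_eq_square)
  qed
  have in_span: "e \<in> span (\<phi> ` ?F)" if "(\<Sum>k\<in>?F. (e \<bullet> \<phi> k)\<^sup>2) = (norm e)\<^sup>2" for e
  proof -
    have "(norm (e - (\<Sum>k\<in>?F. (e \<bullet> \<phi> k) *\<^sub>R \<phi> k)))\<^sup>2 = 0"
      unfolding norm_diff_proj_orthonormal [OF on finite.insertI [OF finite.insertI [OF finite.emptyI]]] that by simp
    then have "e = (\<Sum>k\<in>?F. (e \<bullet> \<phi> k) *\<^sub>R \<phi> k)" by simp
    also have "\<dots> \<in> span (\<phi> ` ?F)"
      by (intro span_sum span_scale span_base) auto
    finally show ?thesis .
  qed
  have n: "(norm ?c)\<^sup>2 = 1" "(norm ?s)\<^sup>2 = 1"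
    using mode_inner [OF j] by (simp_all add: power2_norm_eq_inner)
  have "(\<Sum>k\<in>?F. (?c \<bullet> \<phi> k)\<^sup>2) \<le> 1" "(\<Sum>k\<in>?F. (?s \<bullet> \<phi> k)\<^sup>2) \<le> 1"
    using bessel_inequality [OF on, of ?c] bessel_inequality [OF on, of ?s] n by simp_all
  moreover have "(\<Sum>k\<in>?F. (?c \<bullet> \<phi> k)\<^sup>2) + (\<Sum>k\<in>?F. (?s \<bullet> \<phi> k)\<^sup>2) = 2"
    using norm1 [of "2 * j"] norm1 [of "2 * j + 1"] by (simp add: inner_commute)
  ultimately have "(\<Sum>k\<in>?F. (?c \<bullet> \<phi> k)\<^sup>2) = 1" "(\<Sum>k\<in>?F. (?s \<bullet> \<phi> k)\<^sup>2) = 1"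
    by linarith+
  then have "{?c, ?s} \<subseteq> span (\<phi> ` ?F)"
    using in_span [of ?c] in_span [of ?s] n by simp
  moreover have "\<phi> ` ?F \<subseteq> span {?c, ?s}"
    using sp by auto
  ultimately have "span (\<phi> ` ?F) = span {?c, ?s}"
    by (metis span_minimal subspace_span subset_antisym)
  with on show ?thesis by (simp add: orthonormal_basis_of_iff)
qed

section \<open>Minimisers\<close>

text \<open>Treats the signed constant as member number 1 of a single family, so that orthonormal
  expansions over \<open>{1..CARD('d)}\<close> apply.\<close>

lemma trigonometric_form_iff:
  fixes \<Phi> :: "real ^ 'd \<Rightarrow> l2"
  shows "trigonometric_form u \<Phi> \<longleftrightarrow>
    (\<exists>s \<phi>. (s = 1 \<or> s = -1) \<and>
      (\<forall>j\<ge>1. orthonormal_basis_of \<phi> {2 * j, 2 * j + 1} (span {cos_mode j, sin_mode j})) \<and>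
      (\<forall>x. \<Phi> x = (\<Sum>k=1..CARD('d). (x \<bullet> u k) *\<^sub>R (if k = 1 then s *\<^sub>R one_l2 else \<phi> k))))"
proof -
  have d: "1 \<le> CARD('d)" using zero_less_card_finite [where 'a = 'd] by linarith
  have "(\<Sum>k=1..CARD('d). (x \<bullet> u k) *\<^sub>R (if k = 1 then s *\<^sub>R one_l2 else \<phi> k)) =
      (s * (u 1 \<bullet> x)) *\<^sub>R one_l2 + (\<Sum>k=2..CARD('d). (u k \<bullet> x) *\<^sub>R \<phi> k)"
    for x :: "real ^ 'd" and s and \<phi> :: "nat \<Rightarrow> l2"
    unfolding sum.atLeast_Suc_atMost [OF d]
    by (auto simp: inner_commute mult.commute numeral_2_eq_2 intro!: sum.cong)
  then show ?thesis unfolding trigonometric_form_def by simp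
qed

text \<open>Within a pair orthonormality is assumed; across pairs, and against the constant, it
  follows from the different frequencies. The energies are exact because each member is a unit
  vector of one frequency.\<close>

lemma orthonormal_trigonometric:
  assumes s: "s = 1 \<or> s = (-1 :: real)"
    and \<phi>: "\<And>j. j \<ge> 1 \<Longrightarrow> orthonormal_basis_of \<phi> {2 * j, 2 * j + 1} (span {cos_mode j, sin_mode j})"
  defines "\<psi> \<equiv> \<lambda>k. if k = 1 then s *\<^sub>R one_l2 else \<phi> k"
  shows "orthonormal_on \<psi> {1..}"
    and "k \<ge> 1 \<Longrightarrow> \<psi> k \<in> sobolev \<and> (norm (D (\<psi> k)))\<^sup>2 = mode_energy k"
proof -
  have pair: "k \<in> {2 * (k div 2), 2 * (k div 2) + 1}" for k :: nat by simp presburger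
  have in_span: "\<phi> k \<in> span {cos_mode (k div 2), sin_mode (k div 2)}" if "k \<ge> 2" for k
  proof -
    have "\<phi> k \<in> span (\<phi> ` {2 * (k div 2), 2 * (k div 2) + 1})"
      using pair by (intro span_base imageI)
    then show ?thesis
      using \<phi> [of "k div 2"] that by (simp add: orthonormal_basis_of_iff)
  qed
  have one: "one_l2 \<bullet> one_l2 = 1"
    using orthonormal_onD [OF orthonormal_trig_mode, of 1 1] by (simp add: trig_mode_simps)
  have one_phi: "\<phi> k \<bullet> one_l2 = 0" if "k \<ge> 2" for k
    using pure_frequency_orthogonal [OF _ in_span [OF that], of 1] that by (simp add: trig_mode_simps)
  have phi: "\<phi> k \<bullet> \<phi> l = (if k = l then 1 else 0)" if "k \<ge> 2" "l \<ge> 2" for k l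
  proof (cases "k div 2 = l div 2")
    case True
    have "orthonormal_on \<phi> {2 * (k div 2), 2 * (k div 2) + 1}"
      using \<phi> [of "k div 2"] that by (simp add: orthonormal_basis_of_iff)
    then show ?thesis using pair [of k] pair [of l] unfolding True by (rule orthonormal_onD)
  next
    case False
    then show ?thesis
      using pure_frequencies_orthogonal [OF _ in_span [OF that(1)] _ in_span [OF that(2)]] that by auto
  qed
  show on: "orthonormal_on \<psi> {1..}"
    unfolding orthonormal_on_def \<psi>_def
    using s one one_phi phi by (auto simp: inner_commute [of one_l2 "\<phi> _"])
  show "\<psi> k \<in> sobolev \<and> (norm (D (\<psi> k)))\<^sup>2 = mode_energy k" if "k \<ge> 1"
  proof (cases "k = 1")
    case True
    have "has_weak_deriv one_l2 (abs_l2 (\<lambda>_. 0))"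
      unfolding one_l2_def by (rule has_weak_deriv_periodic) (auto intro!: derivative_eq_intros)
    from has_weak_deriv_scale [OF this, of s] True show ?thesis
      by (auto simp: \<psi>_def sobolev_def mode_energy_def D_eqI simp flip: zero_l2_def)
  next
    case False
    with that have k: "k \<ge> 2" by simp
    have "k div 2 \<ge> 1" using k by linarith
    from pure_frequency_energy [OF this in_span [OF k]] show ?thesis
      using phi [OF k k] False by (simp add: \<psi>_def mode_energy_def power2_norm_eq_inner)
  qed
qed

text \<open>\<open>\<Phi>\<close> carries the orthonormal basis \<open>u\<close> to the orthonormal
  family \<open>\<psi>\<close>, hence is an isometry, and the energies of \<open>\<psi>\<close>
  reproduce the bound term by term.\<close>

lemma trigonometric_form_minimal:
  fixes X :: "real ^ 'n ^ 'd"
  assumes lsb: "left_singular_basis X u" and form: "trigonometric_form u \<Phi>"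
  shows "\<Phi> \<in> sobolev_isometries" "mean_quadratic_variation X \<Phi> = mqv_bound X"
proof -
  note u = left_singular_basisD [OF lsb]
  obtain s \<phi> where s: "s = 1 \<or> s = -1"
    and \<phi>: "\<And>j. j \<ge> 1 \<Longrightarrow> orthonormal_basis_of \<phi> {2 * j, 2 * j + 1} (span {cos_mode j, sin_mode j})"
    and \<Phi>: "\<And>x. \<Phi> x = (\<Sum>k=1..CARD('d). (x \<bullet> u k) *\<^sub>R (if k = 1 then s *\<^sub>R one_l2 else \<phi> k))"
    using form unfolding trigonometric_form_iff by blast
  define \<psi> where "\<psi> = (\<lambda>k. if k = 1 then s *\<^sub>R one_l2 else \<phi> k)"
  note \<Phi> = \<Phi> [folded \<psi>_def [THEN fun_cong]]
  have \<psi>: "orthonormal_on \<psi> {1..CARD('d)}"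
    "\<And>k. k \<ge> 1 \<Longrightarrow> \<psi> k \<in> sobolev \<and> (norm (D (\<psi> k)))\<^sup>2 = mode_energy k"
    using orthonormal_trigonometric [OF s \<phi>] orthonormal_on_subset [of \<psi> "{1..}" "{1..CARD('d)}"]
    by (auto simp: \<psi>_def)
  have "linear \<Phi>"
    by (rule linearI) (simp_all add: \<Phi> inner_add_left scaleR_add_left sum.distrib scaleR_sum_right)
  moreover have "norm (\<Phi> x) = norm x" for x
  proof -
    have "(norm (\<Phi> x))\<^sup>2 = (\<Sum>k=1..CARD('d). (x \<bullet> u k)\<^sup>2)"
      unfolding \<Phi> by (rule norm_sum_orthonormal [OF \<psi>(1)]) simp
    also have "\<dots> = (norm (\<Sum>k=1..CARD('d). (x \<bullet> u k) *\<^sub>R u k))\<^sup>2"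
      by (rule norm_sum_orthonormal [OF u(1), symmetric]) simp
    also have "(\<Sum>k=1..CARD('d). (x \<bullet> u k) *\<^sub>R u k) = x"
      by (rule expansion_orthonormal [OF u(1), symmetric]) (use u(2) in auto)
    finally show ?thesis by simp
  qed
  moreover have "\<Phi> x \<in> sobolev" for x
    unfolding \<Phi> by (rule sobolev_sum) (use \<psi>(2) in auto)
  ultimately show iso: "\<Phi> \<in> sobolev_isometries"
    by (auto simp: sobolev_isometries_def)
  have "\<Phi> (u k) = \<psi> k" if "k \<in> {1..CARD('d)}" for k
  proof -
    have "\<Phi> (u k) = (\<Sum>l=1..CARD('d). if l = k then \<psi> l else 0)"
      unfolding \<Phi> by (intro sum.cong refl) (use orthonormal_onD [OF u(1) that] in auto)
    then show ?thesis using that by simp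
  qed
  then show "mean_quadratic_variation X \<Phi> = mqv_bound X"
    unfolding mean_quadratic_variation_eq [OF lsb iso] mqv_bound_eq
    using \<psi>(2) by (auto intro!: sum.cong)
qed

lemma trigonometric_form_exists:
  "\<exists>\<Phi> :: real ^ 'd \<Rightarrow> l2. trigonometric_form u \<Phi>"
proof -
  have "orthonormal_basis_of trig_mode {2 * j, 2 * j + 1} (span {cos_mode j, sin_mode j})" if "j \<ge> 1" for j
    using that orthonormal_on_subset [OF orthonormal_trig_mode, of "{2 * j, 2 * j + 1}"]
    by (auto simp: orthonormal_basis_of_iff trig_mode_simps)
  then show ?thesis
    unfolding trigonometric_form_iff
    by (intro exI [of _ "\<lambda>x. \<Sum>k=1..CARD('d). (x \<bullet> u k) *\<^sub>R (if k = 1 then 1 *\<^sub>R one_l2 else trig_mode k)"]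
        exI [of _ 1] exI [of _ trig_mode]) simp
qed

section \<open>The lower bound and its equality case\<close>

lemma isometry_orthonormal:
  fixes X :: "real ^ 'n ^ 'd"
  assumes "left_singular_basis X u" "\<Phi> \<in> sobolev_isometries"
  shows "orthonormal_on (\<lambda>k. \<Phi> (u k)) {1..CARD('d)}"
  using left_singular_basisD(1) [OF assms(1)] sobolev_isometriesD(4) [OF assms(2)]
  by (simp add: orthonormal_on_def)

text \<open>Ky Fan for the first \<open>m\<close> images; these are the prefix sums that summation
  by parts requires.\<close>

lemma excess_prefix_nonneg:
  fixes X :: "real ^ 'n ^ 'd"
  assumes lsb: "left_singular_basis X u" and iso: "\<Phi> \<in> sobolev_isometries" and m: "m \<le> CARD('d)"
  shows "0 \<le> (\<Sum>k=1..m. (norm (D (\<Phi> (u k))))\<^sup>2 - mode_energy k)"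
  using sum_mode_energy_le [of "\<lambda>k. \<Phi> (u k)" m] orthonormal_on_subset [OF isometry_orthonormal [OF lsb iso], of "{1..m}"]
    sobolev_isometriesD(3) [OF iso] m
  by (simp add: sum_subtractf)

lemma mean_quadratic_variation_excess:
  fixes X :: "real ^ 'n ^ 'd"
  assumes lsb: "left_singular_basis X u" and iso: "\<Phi> \<in> sobolev_isometries"
  shows "mean_quadratic_variation X \<Phi> - mqv_bound X = 1 / real CARD('n) *
    (\<Sum>k=1..CARD('d). (singular_value X k)\<^sup>2 * ((norm (D (\<Phi> (u k))))\<^sup>2 - mode_energy k))"
  unfolding mean_quadratic_variation_eq [OF lsb iso] mqv_bound_eq
  by (simp only: right_diff_distrib sum_subtractf)

lemma mean_quadratic_variation_ge:
  fixes X :: "real ^ 'n ^ 'd"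
  assumes lsb: "left_singular_basis X u" and iso: "\<Phi> \<in> sobolev_isometries"
  shows "mqv_bound X \<le> mean_quadratic_variation X \<Phi>"
proof -
  have "0 \<le> (\<Sum>k=1..CARD('d). (singular_value X k)\<^sup>2 * ((norm (D (\<Phi> (u k))))\<^sup>2 - mode_energy k))"
    by (rule weighted_sum_nonneg)
       (use singular_value_sorted [OF lsb] excess_prefix_nonneg [OF lsb iso] in \<open>auto intro!: power_mono\<close>)
  then have "0 \<le> mean_quadratic_variation X \<Phi> - mqv_bound X"
    unfolding mean_quadratic_variation_excess [OF lsb iso] by (intro mult_nonneg_nonneg) auto
  then show ?thesis by simp
qed

text \<open>Strong induction on the index. For each frequency \<open>l\<close> with
  \<open>1 \<le> l\<close> below \<open>k div 2\<close>, the vectors \<open>f (2 * l)\<close> and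
  \<open>f (2 * l + 1)\<close> already fill the plane of frequency \<open>l\<close>, so
  \<open>f k\<close> is orthogonal to it; minimal energy then fixes the frequency of
  \<open>f k\<close>.\<close>

lemma minimal_energies_imp_trigonometric:
  fixes f :: "nat \<Rightarrow> l2"
  assumes on: "orthonormal_on f {1..d}" and d: "d \<ge> 1"
    and sob: "\<And>k. k \<in> {1..d} \<Longrightarrow> f k \<in> sobolev"
    and energy: "\<And>k. k \<in> {1..d} \<Longrightarrow> (norm (D (f k)))\<^sup>2 = mode_energy k"
  obtains s where "s = 1 \<or> s = (-1 :: real)" "f 1 = s *\<^sub>R one_l2"
    and "\<And>k. k \<in> {2..d} \<Longrightarrow> f k \<in> span {cos_mode (k div 2), sin_mode (k div 2)}"
proof -
  have norm1: "norm (f k) = 1" if "k \<in> {1..d}" for k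
    using orthonormal_onD [OF on that that] by (simp add: norm_eq_sqrt_inner)
  define s where "s = f 1 \<bullet> one_l2"
  have "f 1 \<bullet> trig_mode k = 0" if k: "k \<in> {1..} - {1}" for k
  proof -
    \<comment> \<open>\<open>mode_energy 1 = 0\<close>, so \<open>D (f 1)\<close> has norm 0 and
      every term of its non-negative energy series vanishes.\<close>
    have "mode_energy k * (f 1 \<bullet> trig_mode k)\<^sup>2 = 0"
      by (rule nonneg_has_sum_le_0D [OF norm_D_has_sum [OF sob [of 1]]])
         (use d energy [of 1] k in \<open>auto simp: mode_energy_def\<close>)
    moreover have "mode_energy k \<noteq> 0" using k by (auto simp: mode_energy_def)
    ultimately show ?thesis by simp
  qed
  then have f1: "f 1 = s *\<^sub>R one_l2"
    using trig_mode_expansion [of "{1}" "f 1"] by (simp add: trig_mode_simps s_def)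
  have "norm one_l2 = 1"
    using orthonormal_onD [OF orthonormal_trig_mode, of 1 1] by (simp add: trig_mode_simps norm_eq_sqrt_inner)
  then have "\<bar>s\<bar> = 1" using norm1 [of 1] d f1 by simp
  then have s: "s = 1 \<or> s = -1" by linarith
  have "f k \<in> span {cos_mode (k div 2), sin_mode (k div 2)}" if "k \<in> {2..d}" for k
    using that
  proof (induction k rule: less_induct)
    case (less k)
    define j where "j = k div 2"
    have j: "j \<ge> 1" using less.prems by (auto simp: j_def)
    have "f k \<bullet> trig_mode i = 0" if i: "i \<ge> 1" "i div 2 < j" for i
    proof (cases "i = 1")
      case True
      have "s * (f k \<bullet> one_l2) = f k \<bullet> f 1" by (simp only: f1 inner_scaleR_right)
      also have "\<dots> = 0" using orthonormal_onD [OF on, of k 1] less.prems by auto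
      finally show ?thesis using s True by (auto simp: trig_mode_simps)
    next
      case False
      define l where "l = i div 2"
      have l: "l \<ge> 1" "l < j" using False i by (auto simp: l_def)
      \<comment> \<open>The whole pair of frequency \<open>l\<close> precedes \<open>k\<close>, so
        the induction hypothesis covers both members.\<close>
      have lt: "2 * l + 1 < k" using l by (auto simp: j_def)
      have "orthonormal_basis_of f {2 * l, 2 * l + 1} (span {cos_mode l, sin_mode l})"
      proof (rule pure_frequency_basisI [OF l(1)])
        show "orthonormal_on f {2 * l, 2 * l + 1}"
          by (rule orthonormal_on_subset [OF on]) (use l lt less.prems in auto)
        show "f (2 * l) \<in> span {cos_mode l, sin_mode l}" "f (2 * l + 1) \<in> span {cos_mode l, sin_mode l}"
          using less.IH [of "2 * l"] less.IH [of "2 * l + 1"] l lt less.prems by auto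
      qed
      then have sp: "span (f ` {2 * l, 2 * l + 1}) = span {cos_mode l, sin_mode l}"
        by (simp add: orthonormal_basis_of_iff)
      have "i = 2 * l \<or> i = 2 * l + 1" unfolding l_def by presburger
      then have "trig_mode i \<in> span (f ` {2 * l, 2 * l + 1})"
        unfolding sp using l(1) by (auto simp: trig_mode_simps intro: span_base)
      moreover have "orthogonal (f k) y" if "y \<in> f ` {2 * l, 2 * l + 1}" for y
        using that orthonormal_onD [OF on, of k] l lt less.prems by (auto simp: orthogonal_def)
      ultimately have "orthogonal (f k) (trig_mode i)"
        using orthogonal_to_span by blast
      then show ?thesis by (simp add: orthogonal_def)
    qed
    moreover have "(norm (D (f k)))\<^sup>2 \<le> mode_energy (2 * j) * (norm (f k))\<^sup>2"
      using energy [of k] norm1 [of k] less.prems by (simp add: mode_energy_def j_def)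
    ultimately show ?case
      unfolding j_def [symmetric]
      by (intro energy_minimal_imp_pure_frequency sob j) (use less.prems in auto)
  qed
  with s f1 that show thesis by blast
qed

text \<open>Once the equality case has fixed the frequencies of the \<open>f k\<close>, it remains
  to extend them to a family \<open>\<phi>\<close> with a full orthonormal pair at every frequency,
  as the trigonometric form demands.\<close>

lemma minimizer_trigonometric:
  fixes X :: "real ^ 'n ^ 'd"
  assumes lsb: "left_singular_basis X u"
    and inj: "inj_on (singular_value X) {1..CARD('d)}"
    and nz: "\<And>k. k \<in> {1..CARD('d)} \<Longrightarrow> singular_value X k \<noteq> 0"
    and iso: "\<Phi> \<in> sobolev_isometries" and le: "mean_quadratic_variation X \<Phi> \<le> mqv_bound X"
  shows "trigonometric_form u \<Phi>"
proof -
  let ?d = "CARD('d)"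
  define f where "f k = \<Phi> (u k)" for k
  have on: "orthonormal_on f {1..?d}"
    unfolding f_def by (rule isometry_orthonormal [OF lsb iso])
  have d: "?d \<ge> 1" using zero_less_card_finite [where 'a = 'd] by linarith
  have pos: "0 < singular_value X k" if "k \<in> {1..?d}" for k
    using singular_value_sorted(1) [OF lsb that] nz [OF that] by simp
  have strict: "singular_value X (Suc k) < singular_value X k" if "1 \<le> k" "k < ?d" for k
    using singular_value_sorted(2) [OF lsb, of k "Suc k"] inj_onD [OF inj, of k "Suc k"] that by fastforce
  have "(\<Sum>k=1..?d. (singular_value X k)\<^sup>2 * ((norm (D (f k)))\<^sup>2 - mode_energy k)) = 0"
    using mean_quadratic_variation_excess [OF lsb iso] mean_quadratic_variation_ge [OF lsb iso] le
    by (simp add: f_def)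
  then have "(norm (D (f k)))\<^sup>2 - mode_energy k = 0" if "k \<in> {1..?d}" for k
  proof (rule weighted_sum_zero [rotated 3])
    show "0 < (singular_value X i)\<^sup>2" if "1 \<le> i" "i \<le> ?d" for i
      using pos [of i] that by simp
    show "(singular_value X (Suc i))\<^sup>2 < (singular_value X i)\<^sup>2" if "1 \<le> i" "i < ?d" for i
      using strict [OF that] pos [of "Suc i"] that by (intro power_strict_mono) auto
    show "0 \<le> (\<Sum>k=1..m. (norm (D (f k)))\<^sup>2 - mode_energy k)" if "m \<le> ?d" for m
      unfolding f_def by (rule excess_prefix_nonneg [OF lsb iso that])
  qed (rule that)
  then have "(norm (D (f k)))\<^sup>2 = mode_energy k" if "k \<in> {1..?d}" for k
    using that by fastforce
  moreover have "f k \<in> sobolev" for k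
    unfolding f_def by (rule sobolev_isometriesD(3) [OF iso])
  ultimately obtain s where s: "s = 1 \<or> s = (-1 :: real)" "f 1 = s *\<^sub>R one_l2"
    and sp: "\<And>k. k \<in> {2..?d} \<Longrightarrow> f k \<in> span {cos_mode (k div 2), sin_mode (k div 2)}"
    using minimal_energies_imp_trigonometric [OF on d] by metis
  text \<open>If \<^term>\<open>CARD('d)\<close> is even, \<^term>\<open>f CARD('d)\<close> has no partner; rotating it by a right angle
    supplies one.\<close>
  define a b where "a = f ?d \<bullet> cos_mode (?d div 2)" and "b = f ?d \<bullet> sin_mode (?d div 2)"
  define \<phi> where "\<phi> k =
    (if k \<le> ?d then f k
     else if k = ?d + 1 \<and> even ?d then (- b) *\<^sub>R cos_mode (?d div 2) + a *\<^sub>R sin_mode (?d div 2)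
     else trig_mode k)" for k
  have "orthonormal_basis_of \<phi> {2 * j, 2 * j + 1} (span {cos_mode j, sin_mode j})" if j: "j \<ge> 1" for j
  proof -
    \<comment> \<open>The pair at \<open>j\<close> comes entirely from \<open>f\<close>, or only its
      first member does, or neither does.\<close>
    consider "2 * j + 1 \<le> ?d" | "?d = 2 * j" | "?d < 2 * j" by linarith
    then have "orthonormal_on \<phi> {2 * j, 2 * j + 1} \<and>
      \<phi> (2 * j) \<in> span {cos_mode j, sin_mode j} \<and> \<phi> (2 * j + 1) \<in> span {cos_mode j, sin_mode j}"
    proof cases
      case 1
      then have "orthonormal_on f {2 * j, 2 * j + 1}"
        using j by (intro orthonormal_on_subset [OF on]) auto
      moreover have "f (2 * j) \<in> span {cos_mode j, sin_mode j}" "f (2 * j + 1) \<in> span {cos_mode j, sin_mode j}"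
        using sp [of "2 * j"] sp [of "2 * j + 1"] 1 j by auto
      ultimately show ?thesis using 1 by (simp add: \<phi>_def orthonormal_on_def)
    next
      case 2
      have f_span: "f (2 * j) \<in> span {cos_mode j, sin_mode j}"
        using sp [of "2 * j"] 2 j by auto
      have f: "f (2 * j) = a *\<^sub>R cos_mode j + b *\<^sub>R sin_mode j"
        using pure_frequency_expansion [OF j f_span] by (simp add: a_def b_def 2)
      have "f (2 * j) \<bullet> f (2 * j) = 1"
        using orthonormal_onD [OF on, of "2 * j" "2 * j"] 2 j by simp
      then have ab: "a * a + b * b = 1"
        unfolding f using mode_inner [OF j] by (simp add: inner_add_left inner_add_right inner_commute [of "sin_mode j" "cos_mode j"])
      have \<phi>: "\<phi> (2 * j) = a *\<^sub>R cos_mode j + b *\<^sub>R sin_mode j"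
        "\<phi> (2 * j + 1) = (- b) *\<^sub>R cos_mode j + a *\<^sub>R sin_mode j"
        by (simp_all add: \<phi>_def 2 f)
      have "\<phi> (2 * j) \<in> span {cos_mode j, sin_mode j}" "\<phi> (2 * j + 1) \<in> span {cos_mode j, sin_mode j}"
        unfolding \<phi> by (intro span_add span_scale span_base; simp)+
      moreover have "\<phi> (2 * j) \<bullet> \<phi> (2 * j) = 1" "\<phi> (2 * j + 1) \<bullet> \<phi> (2 * j + 1) = 1"
        "\<phi> (2 * j) \<bullet> \<phi> (2 * j + 1) = 0" "\<phi> (2 * j + 1) \<bullet> \<phi> (2 * j) = 0"
        unfolding \<phi> using mode_inner [OF j] ab
        by (simp_all add: inner_add_left inner_add_right inner_diff_left inner_diff_right inner_commute [of "sin_mode j" "cos_mode j"])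
      ultimately show ?thesis by (simp add: orthonormal_on_def)
    next
      case 3
      \<comment> \<open>Parity excludes the rotated branch of \<open>\<phi>\<close> at
        \<open>2 * j\<close>; at \<open>2 * j + 1\<close> the case assumption excludes it.\<close>
      moreover have "\<not> (2 * j = ?d + 1 \<and> even ?d)" by presburger
      ultimately have \<phi>: "\<phi> (2 * j) = trig_mode (2 * j)" "\<phi> (2 * j + 1) = trig_mode (2 * j + 1)"
        by (auto simp: \<phi>_def)
      have "orthonormal_on \<phi> {2 * j, 2 * j + 1}"
        using orthonormal_on_subset [OF orthonormal_trig_mode, of "{2 * j, 2 * j + 1}"] j \<phi>
        by (simp add: orthonormal_on_def)
      then show ?thesis using \<phi> j by (simp add: trig_mode_simps span_base)
    qed
    then show ?thesis by (intro pure_frequency_basisI [OF j]) auto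
  qed
  moreover have "\<Phi> x = (\<Sum>k=1..?d. (x \<bullet> u k) *\<^sub>R (if k = 1 then s *\<^sub>R one_l2 else \<phi> k))" for x
    unfolding isometry_expansion [OF lsb sobolev_isometriesD(1) [OF iso], of x]
    by (intro sum.cong refl) (use s(2) in \<open>auto simp: \<phi>_def f_def\<close>)
  ultimately show ?thesis
    unfolding trigonometric_form_iff using s(1) by blast
qed

theorem corollary1:
  fixes X :: "real ^ 'n ^ 'd" and u :: "nat \<Rightarrow> real ^ 'd"
  assumes "left_singular_basis X u"
  shows "(\<forall>\<Phi>\<in>sobolev_isometries. mqv_bound X \<le> mean_quadratic_variation X \<Phi>) \<and>
         (\<forall>\<Phi>. trigonometric_form u \<Phi> \<longrightarrow>
            \<Phi> \<in> sobolev_isometries \<and> mean_quadratic_variation X \<Phi> = mqv_bound X) \<and>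
         (inj_on (singular_value X) {1..CARD('d)} \<and>
          (\<forall>k\<in>{1..CARD('d)}. singular_value X k \<noteq> 0) \<longrightarrow>
            (\<forall>\<Phi>. is_arg_min (mean_quadratic_variation X) (\<lambda>\<Psi>. \<Psi> \<in> sobolev_isometries) \<Phi>
                 \<longleftrightarrow> trigonometric_form u \<Phi>))"
proof (intro conjI ballI allI impI)
  show "mqv_bound X \<le> mean_quadratic_variation X \<Phi>" if "\<Phi> \<in> sobolev_isometries" for \<Phi>
    using assms that by (rule mean_quadratic_variation_ge)
  show "\<Phi> \<in> sobolev_isometries" "mean_quadratic_variation X \<Phi> = mqv_bound X"
    if "trigonometric_form u \<Phi>" for \<Phi>
    using trigonometric_form_minimal [OF assms that] by auto
  fix \<Phi>
  assume sv: "inj_on (singular_value X) {1..CARD('d)} \<and> (\<forall>k\<in>{1..CARD('d)}. singular_value X k \<noteq> 0)"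
  \<comment> \<open>A form attaining the bound shows that the minimum equals
    \<open>mqv_bound X\<close>, so any minimiser has value at most the bound, as
    \<open>minimizer_trigonometric\<close> requires.\<close>
  obtain \<Psi> :: "real ^ 'd \<Rightarrow> l2" where \<Psi>: "trigonometric_form u \<Psi>"
    using trigonometric_form_exists by blast
  show "is_arg_min (mean_quadratic_variation X) (\<lambda>\<Psi>. \<Psi> \<in> sobolev_isometries) \<Phi> \<longleftrightarrow> trigonometric_form u \<Phi>"
    unfolding is_arg_min_linorder
    using trigonometric_form_minimal [OF assms] mean_quadratic_variation_ge [OF assms]
      minimizer_trigonometric [OF assms] sv \<Psi> by metis
qed

end
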